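(* Let $N\ge2$. For every $\mu>1$ there exists a super-exponential function $f:[0,\infty)\to[0,\infty)$ satisfying $(f_1)$, $(f_2)$, $(f_3)$ (listed in the context) and $$\lim_{t\to\infty}f(t)e^{-t^\mu}=0,\qquad \lim_{t\to\infty}f(t)e^{-t^{\mu-\epsilon}}=\infty\quad\text{for all }\epsilon>0,$$ such that the corresponding problem $(P_{0,\frac12})$ admits a radial solution that blows up only at the origin.
   Context: $B_R\subset\mathbb R^N$ is the open ball of radius $R$ centred at $0$; $\Delta_N u=\operatorname{div}(|\nabla u|^{N-2}\nabla u)$. $L^\infty_{\rm loc}(\overline B_R\setminus\{0\})$ denotes functions essentially bounded on compact subsets of $\overline B_R\setminus\{0\}$. Conditions on $f$: $(f_1)$ $f$ is locally Hölder continuous on $[0,\infty)$ with some exponent $\theta\in(0,1)$; $(f_2)$ $\liminf_{t\to\infty}f(t)t^{1-N}>0$; $(f_3)$ there is $\kappa>0$ such that $t\mapsto f(t)+\kappa t^{N-1}$ is non-decreasing on $[0,\infty)$. $f$ is sub-exponential if there is $\beta>0$ with $\sup_{t\ge0}f(t)e^{-\beta t}<\infty$; it is super-exponential if it is not sub-exponential. $u\ge0$ is a solution of $(P_{0,R})$ if $u\in L^1_{\rm loc}(B_R)$, $|\nabla u|\in L^{N-1}_{\rm loc}(B_R)$, $f(u)\in L^\infty_{\rm loc}(\overline B_R\setminus\{0\})\cap L^1(B_R)$ and $-\Delta_N u=f(u)$ in $\mathcal D'(B_R)$, i.e. $\int_{B_R}|\nabla u|^{N-2}\nabla u\cdot\nabla\phi\,dx=\int_{B_R}f(u)\phi\,dx$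 for all $\phi\in C_0^\infty(B_R)$. "Blows up only at the origin" means $u(x)\to\infty$ as $x\to0$ and $u\in L^\infty_{\rm loc}(\overline B_R\setminus\{0\})$. *)

theory Defs
  imports "HOL-Analysis.Analysis"
begin

text \<open>A nonlinearity $f : [0,\infty) \to \mathbb{R}$ is a total function on the reals of which only
  the values on \<open>{0..}\<close> are ever constrained.\<close>

definition locally_holder_on :: "real \<Rightarrow> real set \<Rightarrow> (real \<Rightarrow> real) \<Rightarrow> bool" where
  "locally_holder_on \<theta> S f \<longleftrightarrow>
     (\<forall>K. compact K \<and> K \<subseteq> S \<longrightarrow>
        (\<exists>C. \<forall>s\<in>K. \<forall>t\<in>K. \<bar>f s - f t\<bar> \<le> C * \<bar>s - t\<bar> powr \<theta>))"

definition cond_f1 :: "(real \<Rightarrow> real) \<Rightarrow> bool" where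
  "cond_f1 f \<longleftrightarrow> (\<exists>\<theta>. 0 < \<theta> \<and> \<theta> < 1 \<and> locally_holder_on \<theta> {0..} f)"

text \<open>The lower limit is taken in the extended reals, since it may be infinite.\<close>

definition cond_f2 :: "nat \<Rightarrow> (real \<Rightarrow> real) \<Rightarrow> bool" where
  "cond_f2 N f \<longleftrightarrow> 0 < Liminf at_top (\<lambda>t. ereal (f t * t powr (1 - real N)))"

definition cond_f3 :: "nat \<Rightarrow> (real \<Rightarrow> real) \<Rightarrow> bool" where
  "cond_f3 N f \<longleftrightarrow> (\<exists>\<kappa>>0. mono_on {0..} (\<lambda>t. f t + \<kappa> * t ^ (N - 1)))"

definition sub_exponential :: "(real \<Rightarrow> real) \<Rightarrow> bool" where
  "sub_exponential f \<longleftrightarrow> (\<exists>\<beta>>0. bdd_above ((\<lambda>t. f t * exp (- \<beta> * t)) ` {0..}))"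

definition super_exponential :: "(real \<Rightarrow> real) \<Rightarrow> bool" where
  "super_exponential f \<longleftrightarrow> \<not> sub_exponential f"

fun Ck_fun :: "nat \<Rightarrow> ('a::euclidean_space \<Rightarrow> real) \<Rightarrow> bool" where
  "Ck_fun 0 \<phi> \<longleftrightarrow> continuous_on UNIV \<phi>"
| "Ck_fun (Suc k) \<phi> \<longleftrightarrow> (\<forall>x. \<phi> differentiable (at x)) \<and>
     (\<forall>i\<in>Basis. Ck_fun k (\<lambda>x. frechet_derivative \<phi> (at x) i))"

definition test_fun :: "'a::euclidean_space set \<Rightarrow> ('a \<Rightarrow> real) \<Rightarrow> bool" where
  "test_fun \<Omega> \<phi> \<longleftrightarrow> (\<forall>k. Ck_fun k \<phi>) \<and>
     compact (closure {x. \<phi> x \<noteq> 0}) \<and> closure {x. \<phi> x \<noteq> 0} \<subseteq> \<Omega>"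

definition grad :: "('a::euclidean_space \<Rightarrow> real) \<Rightarrow> 'a \<Rightarrow> 'a" where
  "grad \<phi> x = (\<Sum>i\<in>Basis. frechet_derivative \<phi> (at x) i *\<^sub>R i)"

definition L1_loc :: "'a::euclidean_space set \<Rightarrow> ('a \<Rightarrow> 'b::euclidean_space) \<Rightarrow> bool" where
  "L1_loc S h \<longleftrightarrow> (\<forall>K. compact K \<and> K \<subseteq> S \<longrightarrow> h absolutely_integrable_on K)"

definition Linf_loc :: "'a::euclidean_space set \<Rightarrow> ('a \<Rightarrow> real) \<Rightarrow> bool" where
  "Linf_loc S h \<longleftrightarrow> (\<forall>K. compact K \<and> K \<subseteq> S \<longrightarrow>
     h \<in> borel_measurable (lebesgue_on K) \<and> (\<exists>C. AE x in lebesgue_on K. \<bar>h x\<bar> \<le> C))"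

definition weak_gradient ::
    "'a::euclidean_space set \<Rightarrow> ('a \<Rightarrow> real) \<Rightarrow> ('a \<Rightarrow> 'a) \<Rightarrow> bool" where
  "weak_gradient \<Omega> u g \<longleftrightarrow> L1_loc \<Omega> u \<and> L1_loc \<Omega> g \<and>
     (\<forall>\<phi>. test_fun \<Omega> \<phi> \<longrightarrow> (\<forall>i\<in>Basis.
        (LINT x:\<Omega>|lebesgue. u x * (grad \<phi> x \<bullet> i)) =
        - (LINT x:\<Omega>|lebesgue. (g x \<bullet> i) * \<phi> x)))"

text \<open>The dimension $N$ is \<open>DIM('a)\<close>. The weak gradient \<open>g\<close> is unique up to a null set; its
  measurability and local integrability are part of \<open>weak_gradient\<close>. The sphere of radius \<open>R\<close> is
  a null set, so the values of \<open>u\<close> there are immaterial in \<open>Linf_loc (cball 0 R - {0})\<close>; the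
  content of including it is boundedness up to the boundary.\<close>

definition solution_P0 ::
    "real \<Rightarrow> (real \<Rightarrow> real) \<Rightarrow> ('a::euclidean_space \<Rightarrow> real) \<Rightarrow> bool" where
  "solution_P0 R f u \<longleftrightarrow>
     (\<forall>x\<in>ball 0 R. 0 \<le> u x) \<and>
     L1_loc (ball 0 R) u \<and>
     Linf_loc (cball 0 R - {0}) (\<lambda>x. f (u x)) \<and>
     (\<lambda>x. f (u x)) absolutely_integrable_on ball 0 R \<and>
     (\<exists>g. weak_gradient (ball 0 R) u g \<and>
          L1_loc (ball 0 R) (\<lambda>x. norm (g x) ^ (DIM('a) - 1)) \<and>
          (\<forall>\<phi>. test_fun (ball 0 R) \<phi> \<longrightarrow>
             (LINT x:ball 0 R|lebesgue. norm (g x) ^ (DIM('a) - 2) * (g x \<bullet> grad \<phi> x)) =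
             (LINT x:ball 0 R|lebesgue. f (u x) * \<phi> x)))"

definition radial_on :: "'a::euclidean_space set \<Rightarrow> ('a \<Rightarrow> real) \<Rightarrow> bool" where
  "radial_on S u \<longleftrightarrow> (\<exists>v. \<forall>x\<in>S. u x = v (norm x))"

definition blows_up_only_at_origin ::
    "real \<Rightarrow> ('a::euclidean_space \<Rightarrow> real) \<Rightarrow> bool" where
  "blows_up_only_at_origin R u \<longleftrightarrow>
     filterlim u at_top (at 0) \<and> Linf_loc (cball 0 R - {0}) u"

end

theory Submission
  imports Defs "HOL-Real_Asymp.Real_Asymp"
begin

text \<open>Write $L = 1 - \ln|x|$ and take $u = (N L)^{1/\mu}$. For a radial function the $N$-Laplacian is
  $|x|^{1-N}$ times the derivative of the flux $q(r) = r^{N-1}|u'|^{N-2}u'$, so $-\Delta_N u$ is an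
  explicit function of $r$; as $u$ is strictly monotone, it is a function $f(u)$, and the substitution
  $e^{u^\mu - N} = r^{-N}$ gives
  $f(t) = (N-1)(\mu-1)(N/\mu)^N e^{t^\mu - N} t^{-1-N(\mu-1)}$ on the range $t \ge N^{1/\mu}$ of $u$ on
  the unit ball. There $f$ is increasing, and it is extended by a constant below. The negative power of $t$
  makes $f(t) e^{-t^\mu}$ vanish at infinity, and it turns $f(u)$ into a multiple of $r^{-N} L^{-1-b}$
  with $b = (N-1)(1-1/\mu) > 0$, which is integrable. The flux tends to $0$ at the origin, so integrating by parts outside a
  small ball produces no point mass there.\<close>

section \<open>Integration by parts across a point singularity\<close>

text \<open>The exponent 1/\<mu> comes from the growth that is wanted: e^{u^\<mu>} has to match the
  critical singularity |x|^{-N} up to powers of L, so u^\<mu> = N L. For \<mu> = 1 this would be the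
  fundamental solution, with f = 0 and a constant flux, hence a Dirac mass; for \<mu> > 1 the
  profile is of lower order than L, so r u' tends to 0 and the mass disappears. The summand 1 in L
  keeps N L \<ge> N on the unit ball, which bounds r u' there and places the range of u where f
  increases; so every radius below 1 is admissible.

  The obstacle is the origin: u, its gradient and f(u) are singular there, while test functions need
  not vanish. Both distributional identities, the one defining the weak gradient and the equation
  itself, are therefore instances of one divergence identity for a field F on the punctured ball,
  used with F = u e_i and F = |grad u|^{N-2} grad u. Integrability of u, of its gradient and of the
  flux field has a power of |x| to spare; f(u) is borderline and integrable only through the
  exponent of L.\<close>

text \<open>By translation invariance every difference quotient has integral zero; pass to the limit.\<close>

lemma
  fixes \<psi> :: "'a::euclidean_space \<Rightarrow> real"
  assumes der: "\<And>x. (\<psi> has_derivative D x) (at x)"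
    and bound: "\<And>x. \<bar>D x v\<bar> \<le> M"
    and supp: "\<And>x. x \<notin> cball 0 R \<Longrightarrow> \<psi> x = 0"
  shows integrable_directional_derivative: "integrable lborel (\<lambda>x. D x v)"
    and integral_directional_derivative: "(LINT x|lborel. D x v) = 0"
proof -
  define h where "h k = 1 / real (Suc k)" for k
  define s where "s k x = (\<psi> (x + h k *\<^sub>R v) - \<psi> x) / h k" for k x
  define w where "w x = M * indicat_real (cball 0 (R + norm v)) x" for x :: 'a
  have h: "0 < h k" "h k \<le> 1" for k
    by (auto simp: h_def)
  have hlim: "h \<longlonglongrightarrow> 0"
    unfolding h_def by (rule LIMSEQ_Suc[OF lim_1_over_n])
  have line: "((\<lambda>t. \<psi> (x + t *\<^sub>R v)) has_real_derivative D (x + t *\<^sub>R v) v) (at t)" for x t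
  proof -
    have "((\<lambda>t. \<psi> (x + t *\<^sub>R v)) has_derivative (\<lambda>t'. D (x + t *\<^sub>R v) (t' *\<^sub>R v))) (at t)"
      by (rule has_derivative_compose[OF _ der]) (auto intro!: derivative_eq_intros)
    moreover have "D (x + t *\<^sub>R v) (t' *\<^sub>R v) = D (x + t *\<^sub>R v) v * t'" for t'
      using linear_cmul[OF has_derivative_linear[OF der[of "x + t *\<^sub>R v"]]] by simp
    ultimately show ?thesis
      by (simp add: has_field_derivative_def)
  qed
  have cont: "continuous_on UNIV \<psi>"
    using der by (intro continuous_at_imp_continuous_on ballI) (rule has_derivative_continuous)
  have bm: "\<psi> \<in> borel_measurable borel"
    by (rule borel_measurable_continuous_onI[OF cont])
  have sm: "s k \<in> borel_measurable lborel" for k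
    unfolding s_def using bm by measurable
  have "(\<lambda>k. s k x) \<longlonglongrightarrow> D x v" for x
  proof -
    have "((\<lambda>t. (\<psi> (x + t *\<^sub>R v) - \<psi> x) / t) \<longlongrightarrow> D x v) (at 0)"
      using line[of x 0] by (simp add: has_field_derivative_iff)
    moreover have "filterlim h (at 0) sequentially"
      using hlim h by (auto simp: filterlim_at intro!: always_eventually less_imp_neq[symmetric])
    ultimately show ?thesis
      unfolding s_def by (rule filterlim_compose)
  qed
  note slim = this
  \<comment> \<open>The derivative is not assumed continuous; its measurability is inherited from
    the difference quotients.\<close>
  have Dm: "(\<lambda>x. D x v) \<in> borel_measurable lborel"
    by (rule borel_measurable_LIMSEQ_real[OF slim sm])
  have wi: "integrable lborel w"
    unfolding w_def by (intro integrable_mult_right integrable_real_indicator emeasure_bounded_finite) auto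
  \<comment> \<open>By the mean value theorem each quotient is a value of the directional
    derivative, hence at most M. Since h \<le> 1, outside radius R + |v| both x and its translate
    lie outside the support, so one integrable majorant serves all k.\<close>
  have sb: "norm (s k x) \<le> w x" for k x
  proof (cases "x \<in> cball 0 (R + norm v)")
    case True
    obtain z where "\<psi> (x + h k *\<^sub>R v) - \<psi> (x + 0 *\<^sub>R v) = (h k - 0) * D (x + z *\<^sub>R v) v"
      using MVT2[OF h(1), where f = "\<lambda>t. \<psi> (x + t *\<^sub>R v)" and f' = "\<lambda>t. D (x + t *\<^sub>R v) v"] line by blast
    then have "s k x = D (x + z *\<^sub>R v) v"
      using h[of k] by (simp add: s_def)
    then show ?thesis
      using bound True by (simp add: w_def)
  next
    case False
    have "norm x \<le> norm (x + h k *\<^sub>R v) + norm (h k *\<^sub>R v)"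
      using norm_triangle_ineq4[of "x + h k *\<^sub>R v" "h k *\<^sub>R v"] by simp
    moreover have "norm (h k *\<^sub>R v) \<le> norm v"
      using h[of k] by (simp add: mult_left_le_one_le)
    ultimately have "\<psi> (x + h k *\<^sub>R v) = 0" "\<psi> x = 0"
      using False norm_ge_zero[of v] by (auto intro!: supp simp del: norm_ge_zero)
    then show ?thesis
      using False by (simp add: s_def w_def)
  qed
  have int: "integrable lborel \<psi>"
  proof -
    have "continuous_on (cball 0 R) \<psi>"
      using cont continuous_on_subset by blast
    then have "integrable lborel (\<lambda>x. indicat_real (cball 0 R) x *\<^sub>R \<psi> x)"
      by (rule borel_integrable_compact[OF compact_cball])
    moreover have "(\<lambda>x. indicat_real (cball 0 R) x *\<^sub>R \<psi> x) = \<psi>"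
      using supp by (auto simp: indicator_def fun_eq_iff)
    ultimately show ?thesis by (simp only:)
  qed
  have "(LINT x|lborel. s k x) = 0" for k
  proof -
    have "integrable (distr lborel borel ((+) (h k *\<^sub>R v))) \<psi>"
      using int by (simp add: lborel_distr_plus)
    then have i2: "integrable lborel (\<lambda>x. \<psi> (h k *\<^sub>R v + x))"
      using bm by (simp add: integrable_distr_eq)
    have "(LINT x|lborel. \<psi> (h k *\<^sub>R v + x)) = (LINT x|distr lborel borel ((+) (h k *\<^sub>R v)). \<psi> x)"
      using bm by (simp add: integral_distr)
    also have "\<dots> = (LINT x|lborel. \<psi> x)"
      by (simp add: lborel_distr_plus)
    finally show ?thesis
      using Bochner_Integration.integral_diff[OF i2 int] by (simp add: s_def add.commute)
  qed
  moreover have "(\<lambda>k. LINT x|lborel. s k x) \<longlonglongrightarrow> (LINT x|lborel. D x v)"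
    by (rule integral_dominated_convergence[where s = s and w = w])
      (use Dm sm wi slim sb in auto)
  ultimately show "(LINT x|lborel. D x v) = 0"
    by (simp add: LIMSEQ_const_iff)
  show "integrable lborel (\<lambda>x. D x v)"
    by (rule integrable_dominated_convergence[where s = s and w = w])
      (use Dm sm wi slim sb in auto)
qed

section \<open>A C^1 cutoff that removes a ball around the origin\<close>

lemma DERIV_max_0_power2:
  "((\<lambda>x::real. (max 0 x)\<^sup>2) has_real_derivative 2 * max 0 x) (at x)"
proof -
  consider "x < 0" | "x > 0" | "x = 0" by linarith
  then show ?thesis
  proof cases
    case 1
    have "((\<lambda>x::real. 0) has_real_derivative 2 * max 0 x) (at x)"
      using 1 by auto
    then show ?thesis
      by (rule has_field_derivative_transform_within_open[of _ _ _ "{..<0}"]) (use 1 in auto)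
  next
    case 2
    have "((\<lambda>x::real. x\<^sup>2) has_real_derivative 2 * max 0 x) (at x)"
      using 2 by (auto intro!: derivative_eq_intros)
    then show ?thesis
      by (rule has_field_derivative_transform_within_open[of _ _ _ "{0<..}"]) (use 2 in auto)
  next
    case 3
    have "((\<lambda>h::real. (max 0 h)\<^sup>2 / h) \<longlongrightarrow> 0) (at 0)"
    proof (rule Lim_null_comparison)
      show "\<forall>\<^sub>F h in at 0. norm ((max 0 h)\<^sup>2 / h) \<le> \<bar>h\<bar>"
        by (rule always_eventually) (auto simp: max_def power2_eq_square)
      show "((\<lambda>h::real. \<bar>h\<bar>) \<longlongrightarrow> 0) (at 0)"
        by (rule tendsto_rabs_zero) (rule tendsto_ident_at)
    qed
    then show ?thesis
      using 3 by (simp add: has_field_derivative_iff)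
  qed
qed

text \<open>A $C^1$ transition from $0$ (for $q \le 1$) to $1$ (for $q \ge 2$).\<close>

definition smoothstep :: "real \<Rightarrow> real" where
  "smoothstep q = 1 - (max 0 (1 - (max 0 (q - 1))\<^sup>2))\<^sup>2"

definition smoothstep' :: "real \<Rightarrow> real" where
  "smoothstep' q = 4 * max 0 (1 - (max 0 (q - 1))\<^sup>2) * max 0 (q - 1)"

text \<open>Squaring removes the kink of a positive part, so two nested squared positive parts give
  a C^1 step. One bounded derivative is all that \<open>integral_directional_derivative\<close> asks
  for.\<close>

lemma DERIV_smoothstep: "(smoothstep has_real_derivative smoothstep' q) (at q)"
proof -
  have 1: "((\<lambda>q. 1 - (max 0 (q - 1))\<^sup>2) has_real_derivative - (2 * max 0 (q - 1))) (at q)"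
    using DERIV_diff[OF DERIV_const[of 1] DERIV_chain2[OF DERIV_max_0_power2 DERIV_diff[OF DERIV_ident DERIV_const]]]
    by simp
  have "((\<lambda>q. 1 - (max 0 (1 - (max 0 (q - 1))\<^sup>2))\<^sup>2) has_real_derivative
      0 - 2 * max 0 (1 - (max 0 (q - 1))\<^sup>2) * (- (2 * max 0 (q - 1)))) (at q)"
    by (rule DERIV_diff[OF DERIV_const DERIV_chain2[OF DERIV_max_0_power2 1]])
  moreover have "0 - 2 * max 0 (1 - (max 0 (q - 1))\<^sup>2) * (- (2 * max 0 (q - 1))) = smoothstep' q"
    by (simp add: smoothstep'_def)
  ultimately show ?thesis
    unfolding smoothstep_def[abs_def] by simp
qed

lemma smoothstep_bounds: "0 \<le> smoothstep q" "smoothstep q \<le> 1"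
  by (auto simp: smoothstep_def max_def power_le_one)

lemma smoothstep'_bounds: "0 \<le> smoothstep' q" "smoothstep' q \<le> 4"
proof -
  let ?m = "max 0 (q - 1)" and ?n = "max 0 (1 - (max 0 (q - 1))\<^sup>2)"
  show "0 \<le> smoothstep' q"
    by (auto simp: smoothstep'_def)
  have "?n * ?m \<le> 1"
  proof (cases "?m \<le> 1")
    case True
    then show ?thesis
      by (intro mult_le_one) auto
  next
    case False
    then have "?m\<^sup>2 > 1"
      using one_less_power[of ?m 2] by simp
    then show ?thesis by simp
  qed
  then show "smoothstep' q \<le> 4"
    by (simp add: smoothstep'_def)
qed

lemma smoothstep_eq_0: "q \<le> 1 \<Longrightarrow> smoothstep q = 0"
  and smoothstep_eq_1: "2 \<le> q \<Longrightarrow> smoothstep q = 1"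
  and smoothstep'_eq_0: "q \<le> 1 \<or> 2 \<le> q \<Longrightarrow> smoothstep' q = 0"
proof -
  have *: "max 0 (1 - (max 0 (q - 1))\<^sup>2) = 0" if "2 \<le> q"
  proof -
    have "1 \<le> (q - 1)\<^sup>2"
      using that by (intro one_le_power) simp
    moreover have "max 0 (q - 1) = q - 1"
      using that by simp
    ultimately show ?thesis
      by (intro max_absorb1) linarith
  qed
  show "q \<le> 1 \<Longrightarrow> smoothstep q = 0" "2 \<le> q \<Longrightarrow> smoothstep q = 1"
    "q \<le> 1 \<or> 2 \<le> q \<Longrightarrow> smoothstep' q = 0"
    using * by (auto simp: smoothstep_def smoothstep'_def)
qed

text \<open>The argument is |x|^2/e^2 and not |x|/e, so differentiability at the origin is no
  special case. The transition takes place for e \<le> |x| \<le> sqrt 2 e; the bound 2 e used below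
  is a round value above this.\<close>

definition cutoff :: "real \<Rightarrow> 'a::euclidean_space \<Rightarrow> real" where
  "cutoff e x = smoothstep ((x \<bullet> x) / e\<^sup>2)"

definition cutoff_grad :: "real \<Rightarrow> 'a::euclidean_space \<Rightarrow> 'a" where
  "cutoff_grad e x = (smoothstep' ((x \<bullet> x) / e\<^sup>2) * 2 / e\<^sup>2) *\<^sub>R x"

lemma has_derivative_cutoff:
  "(cutoff e has_derivative (\<lambda>h. cutoff_grad e x \<bullet> h)) (at x)"
proof -
  have "((\<lambda>x. (x \<bullet> x) / e\<^sup>2) has_derivative (\<lambda>h. (x \<bullet> h + h \<bullet> x) / e\<^sup>2)) (at x)"
    unfolding divide_inverse by (auto intro!: derivative_eq_intros)
  then have "((\<lambda>x. smoothstep ((x \<bullet> x) / e\<^sup>2)) has_derivative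
      (\<lambda>h. smoothstep' ((x \<bullet> x) / e\<^sup>2) * ((x \<bullet> h + h \<bullet> x) / e\<^sup>2))) (at x)"
    using DERIV_smoothstep unfolding has_field_derivative_def
    by (rule has_derivative_compose)
  moreover have "(\<lambda>h. smoothstep' ((x \<bullet> x) / e\<^sup>2) * ((x \<bullet> h + h \<bullet> x) / e\<^sup>2)) =
      (\<lambda>h. cutoff_grad e x \<bullet> h)"
    by (rule ext) (simp add: cutoff_grad_def inner_commute)
  ultimately show ?thesis
    unfolding cutoff_def[abs_def] by simp
qed

lemma continuous_on_cutoff: "continuous_on S (cutoff e)"
  by (intro continuous_at_imp_continuous_on ballI has_derivative_continuous[OF has_derivative_cutoff])

lemma continuous_on_cutoff_grad: "continuous_on S (cutoff_grad e)"
  unfolding cutoff_grad_def[abs_def] smoothstep'_def divide_inverse by (intro continuous_intros)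

lemma cutoff_bounds: "0 \<le> cutoff e x" "cutoff e x \<le> 1"
  by (simp_all add: cutoff_def smoothstep_bounds)

text \<open>The scaling is what counts: a gradient O(1/e) on a shell of volume O(e^N), paired with a
  field that is o(e^{1-N}), contributes o(1). The 16 is 4 * 2 * 2, from the bound 4 on
  \<open>smoothstep'\<close>, the factor 2 in the gradient of |x|^2 and |x| \<le> 2 e.\<close>

lemma cutoff_cases:
  fixes x :: "'a::euclidean_space"
  assumes "e > 0"
  shows cutoff_eq_0: "norm x \<le> e \<Longrightarrow> cutoff e x = 0"
    and cutoff_eq_1: "2 * e \<le> norm x \<Longrightarrow> cutoff e x = 1"
    and cutoff_grad_eq_0: "norm x \<le> e \<or> 2 * e \<le> norm x \<Longrightarrow> cutoff_grad e x = 0"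
    and norm_cutoff_grad: "norm (cutoff_grad e x) \<le> 16 / e"
proof -
  have q: "(x \<bullet> x) / e\<^sup>2 = (norm x / e)\<^sup>2"
    by (simp add: power_divide dot_square_norm)
  have 1: "(x \<bullet> x) / e\<^sup>2 \<le> 1" if "norm x \<le> e"
    using that assms by (auto simp: q intro!: power_le_one)
  have 2: "2 \<le> (x \<bullet> x) / e\<^sup>2" if "2 * e \<le> norm x"
  proof -
    have "2 \<le> norm x / e"
      using that assms by (simp add: field_simps)
    from power_mono[OF this, of 2] show ?thesis
      by (simp add: q)
  qed
  show "norm x \<le> e \<Longrightarrow> cutoff e x = 0" "2 * e \<le> norm x \<Longrightarrow> cutoff e x = 1"
    using 1 2 by (auto simp: cutoff_def smoothstep_eq_0 smoothstep_eq_1)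
  show 0: "norm x \<le> e \<or> 2 * e \<le> norm x \<Longrightarrow> cutoff_grad e x = 0"
    using 1 2 smoothstep'_eq_0 unfolding cutoff_grad_def by fastforce
  show "norm (cutoff_grad e x) \<le> 16 / e"
  proof (cases "norm x \<le> 2 * e")
    case True
    have "norm (cutoff_grad e x) = smoothstep' ((x \<bullet> x) / e\<^sup>2) * (2 / e\<^sup>2) * norm x"
      by (simp add: cutoff_grad_def smoothstep'_bounds abs_mult)
    also have "\<dots> \<le> 4 * (2 / e\<^sup>2) * (2 * e)"
      using True assms by (intro mult_mono smoothstep'_bounds) auto
    also have "\<dots> = 16 / e"
      using assms by (simp add: power2_eq_square)
    finally show ?thesis .
  next
    case False
    then show ?thesis
      using 0 assms by simp
  qed
qed

section \<open>Gradients of test functions and products with integrable functions\<close>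

lemma Ck_fun_grad:
  assumes "Ck_fun (Suc 0) \<phi>"
  shows has_derivative_grad: "(\<phi> has_derivative (\<lambda>h. grad \<phi> x \<bullet> h)) (at x)"
    and continuous_on_grad: "continuous_on S (grad \<phi>)"
proof -
  have d: "(\<phi> has_derivative frechet_derivative \<phi> (at x)) (at x)" for x
    using assms by (simp add: frechet_derivative_works[symmetric])
  have "frechet_derivative \<phi> (at x) h = grad \<phi> x \<bullet> h" for h
  proof -
    interpret linear "frechet_derivative \<phi> (at x)"
      using d by (rule has_derivative_linear)
    have "frechet_derivative \<phi> (at x) h = frechet_derivative \<phi> (at x) (\<Sum>i\<in>Basis. (h \<bullet> i) *\<^sub>R i)"
      by (simp add: euclidean_representation)
    also have "\<dots> = (\<Sum>i\<in>Basis. (h \<bullet> i) * frechet_derivative \<phi> (at x) i)"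
      by (simp add: sum scale)
    also have "\<dots> = grad \<phi> x \<bullet> h"
      by (simp add: grad_def inner_sum_left inner_commute[of h] mult.commute)
    finally show ?thesis .
  qed
  then show "(\<phi> has_derivative (\<lambda>h. grad \<phi> x \<bullet> h)) (at x)"
    using d[of x] by presburger
  show "continuous_on S (grad \<phi>)"
    unfolding grad_def[abs_def] using assms
    by (intro continuous_intros) (auto intro: continuous_on_subset)
qed

lemma grad_eq_0:
  assumes "Ck_fun (Suc 0) \<phi>" "open U" "x \<in> U" "\<And>y. y \<in> U \<Longrightarrow> \<phi> y = 0"
  shows "grad \<phi> x = 0"
proof -
  have "((\<lambda>_. 0) has_derivative (\<lambda>_. 0)) (at x)"
    by simp
  then have "(\<phi> has_derivative (\<lambda>_. 0)) (at x)"
    by (rule has_derivative_transform_within_open[OF _ assms(2,3)]) (simp add: assms(4))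
  then have "(\<lambda>h. grad \<phi> x \<bullet> h) = (\<lambda>_. 0)"
    using has_derivative_unique has_derivative_grad[OF assms(1)] by blast
  then show ?thesis
    by (metis inner_eq_zero_iff)
qed

text \<open>Stated for a general bilinear map to cover both the product of a divergence with a test
  function and the inner product of a field with its gradient.\<close>

lemma absolutely_integrable_bounded_bilinear:
  fixes g :: "'a::euclidean_space \<Rightarrow> 'b::euclidean_space" and f :: "'a \<Rightarrow> 'c::euclidean_space"
    and h :: "'b \<Rightarrow> 'c \<Rightarrow> 'd::euclidean_space"
  assumes "bounded_bilinear h" "continuous_on UNIV g" "\<And>x. norm (g x) \<le> M"
    "f absolutely_integrable_on S" "S \<in> sets lebesgue"
  shows "(\<lambda>x. h (g x) (f x)) absolutely_integrable_on S"
proof (rule absolutely_integrable_bounded_measurable_product[where h = h, OF _ _ assms(5) _ assms(4)])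
  show "bilinear h"
    using assms(1) by (simp add: bilinear_conv_bounded_bilinear)
  show "g \<in> borel_measurable (lebesgue_on S)"
    using assms(2,5) continuous_imp_measurable_on_sets_lebesgue continuous_on_subset by blast
  show "bounded (g ` S)"
    using assms(3) by (auto simp: bounded_iff)
qed

lemma continuous_compact_support_bounded:
  fixes f :: "'a::euclidean_space \<Rightarrow> 'b::real_normed_vector"
  assumes "continuous_on K f" "compact K" "\<And>x. x \<notin> K \<Longrightarrow> f x = 0"
  obtains M where "0 < M" "\<And>x. norm (f x) \<le> M"
proof -
  have "bounded (f ` K)"
    using assms(1,2) compact_continuous_image compact_imp_bounded by blast
  then obtain B where "B > 0" "\<forall>x\<in>K. norm (f x) \<le> B"
    unfolding bounded_pos by auto
  then have "norm (f x) \<le> B" for x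
    using assms(3)[of x] by (cases "x \<in> K") auto
  with \<open>B > 0\<close> show ?thesis by (rule that)
qed

text \<open>The condition on $|x|^{N-1}|F|$ makes the flux of \<open>F\<close> through small spheres vanish, so the
  distributional divergence has no point mass at \<open>0\<close>.\<close>

theorem divergence_removable_singularity:
  fixes F :: "'a::euclidean_space \<Rightarrow> 'a" and d :: "'a \<Rightarrow> real"
  assumes der: "\<And>x. x \<in> ball 0 R - {0} \<Longrightarrow> (F has_derivative F' x) (at x)"
    and cont: "\<And>i. i \<in> Basis \<Longrightarrow> continuous_on (ball 0 R - {0}) (\<lambda>x. F' x i \<bullet> i)"
    and div: "\<And>x. x \<in> ball 0 R - {0} \<Longrightarrow> d x = (\<Sum>i\<in>Basis. F' x i \<bullet> i)"
    and Fint: "F absolutely_integrable_on ball 0 R"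
    and dint: "d absolutely_integrable_on ball 0 R"
    and lim: "((\<lambda>x. norm x ^ (DIM('a) - 1) * norm (F x)) \<longlongrightarrow> 0) (at 0)"
    and test: "test_fun (ball 0 R) \<phi>"
  shows "(LINT x:ball 0 R|lebesgue. F x \<bullet> grad \<phi> x) = - (LINT x:ball 0 R|lebesgue. d x * \<phi> x)"
proof -
  define K where "K = closure {x. \<phi> x \<noteq> 0}"
  have K: "compact K" "K \<subseteq> ball 0 R"
    using test by (auto simp: test_fun_def K_def)
  have C1: "Ck_fun (Suc 0) \<phi>"
    using test unfolding test_fun_def by blast
  have \<phi>0: "\<phi> x = 0" if "x \<notin> K" for x
    using that closure_subset[of "{x. \<phi> x \<noteq> 0}"] by (auto simp: K_def)
  have g0: "grad \<phi> x = 0" if "x \<notin> K" for x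
    by (rule grad_eq_0[OF C1, of "- K"]) (use that \<phi>0 K in \<open>auto simp: compact_imp_closed\<close>)
  have \<phi>c: "continuous_on S \<phi>" for S
    by (intro continuous_at_imp_continuous_on ballI has_derivative_continuous[OF has_derivative_grad[OF C1]])
  obtain M where M: "M > 0" "\<And>x. norm (\<phi> x) \<le> M"
    using continuous_compact_support_bounded[OF \<phi>c K(1) \<phi>0] by metis
  obtain M' where M': "M' > 0" "\<And>x. norm (grad \<phi> x) \<le> M'"
    using continuous_compact_support_bounded[OF continuous_on_grad[OF C1] K(1) g0] by metis
  \<comment> \<open>Away from the origin \<open>A\<close> is the divergence of \<open>\<phi>\<close>
    F, so the claim amounts to its integral being zero.\<close>
  define A where "A x = d x * \<phi> x + F x \<bullet> grad \<phi> x" for x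
  have i1: "(\<lambda>x. d x * \<phi> x) absolutely_integrable_on ball 0 R"
    using absolutely_integrable_bounded_bilinear[OF bounded_bilinear_mult \<phi>c M(2) dint]
    by (simp add: mult.commute)
  have i2: "(\<lambda>x. F x \<bullet> grad \<phi> x) absolutely_integrable_on ball 0 R"
    using absolutely_integrable_bounded_bilinear[OF bounded_bilinear_inner continuous_on_grad[OF C1] M'(2) Fint]
    by (simp add: inner_commute)
  have Ai: "A absolutely_integrable_on ball 0 R"
    unfolding A_def[abs_def] using i1 i2 by (rule set_integral_add)
  have A0: "A x = 0" if "x \<notin> K" for x
    using that by (simp add: A_def \<phi>0 g0)
  have Fcont: "continuous_on (ball 0 R - {0}) F"
    using der by (intro continuous_at_imp_continuous_on ballI) (rule has_derivative_continuous)
  \<comment> \<open>The product rule gives div (cutoff \<open>\<phi>\<close> F) = cutoff A + r. The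
    left side integrates to zero, so the integral of cutoff A is minus that of \<open>r\<close>,
    which is supported in a thin shell.\<close>
  define r where "r e x = \<phi> x * (F x \<bullet> cutoff_grad e x)" for e x
  have main: "integrable lebesgue (\<lambda>x. cutoff e x * A x + r e x)"
      "(LINT x|lebesgue. cutoff e x * A x + r e x) = 0" if e: "e > 0" for e
  proof -
    define \<psi> where "\<psi> i x = cutoff e x * \<phi> x * (F x \<bullet> i)" for i x
    define D where "D i x h = cutoff e x * \<phi> x * (F' x h \<bullet> i) + cutoff e x * (grad \<phi> x \<bullet> h) * (F x \<bullet> i)
        + \<phi> x * (cutoff_grad e x \<bullet> h) * (F x \<bullet> i)" for i x h
    \<comment> \<open>Where \<open>\<phi>\<close> and the cutoff are both nonzero. Deleting the open
      ball leaves a compact subset of the punctured ball, on which the continuous partial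
      derivatives are bounded.\<close>
    define K' where "K' = K - ball 0 e"
    have K': "compact K'" "K' \<subseteq> ball 0 R - {0}" "K' \<subseteq> cball 0 R"
      using K e by (auto simp: K'_def compact_diff)
    have out: "cutoff e x * \<phi> x = 0" "cutoff e x *\<^sub>R grad \<phi> x = 0" "\<phi> x *\<^sub>R cutoff_grad e x = 0"
      if "x \<notin> K'" for x
      using that e \<phi>0 g0 cutoff_eq_0[OF e, of x] cutoff_grad_eq_0[OF e, of x]
      by (auto simp: K'_def)
    have D0: "D i x h = 0" if "x \<notin> K'" for i x h
    proof -
      have "D i x h = (cutoff e x * \<phi> x) * (F' x h \<bullet> i) + ((cutoff e x *\<^sub>R grad \<phi> x) \<bullet> h) * (F x \<bullet> i)
        + ((\<phi> x *\<^sub>R cutoff_grad e x) \<bullet> h) * (F x \<bullet> i)"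
        by (simp add: D_def)
      then show ?thesis
        using out[OF that] by simp
    qed
    have \<psi>0: "\<psi> i x = 0" if "x \<notin> K'" for i x
      using out(1)[OF that] by (simp add: \<psi>_def)
    \<comment> \<open>At the origin and outside the ball F need not be differentiable, but the
      product vanishes on the open complement of \<open>K'\<close>, which contains these
      points.\<close>
    have der\<psi>: "(\<psi> i has_derivative D i x) (at x)" for i x
    proof (cases "x \<in> ball 0 R - {0}")
      case True
      show ?thesis
        unfolding \<psi>_def[abs_def]
        by (rule derivative_eq_intros has_derivative_cutoff has_derivative_grad[OF C1] der[OF True] refl)+
          (simp add: D_def fun_eq_iff algebra_simps)
    next
      case False
      have "((\<lambda>_. 0) has_derivative (\<lambda>_. 0)) (at x)"
        by simp
      then have "(\<psi> i has_derivative (\<lambda>_. 0)) (at x)"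
        by (rule has_derivative_transform_within_open[of _ _ _ _ "- K'"])
          (use False K' \<psi>0 in \<open>auto simp: compact_imp_closed\<close>)
      moreover have "D i x = (\<lambda>_. 0)"
        using False K' D0 by blast
      ultimately show ?thesis by simp
    qed
    have Dc: "continuous_on K' (\<lambda>x. D i x i)" if "i \<in> Basis" for i
      unfolding D_def
      using K'(2) that
      by (intro continuous_intros continuous_on_cutoff continuous_on_cutoff_grad \<phi>c
          continuous_on_grad[OF C1] continuous_on_subset[OF Fcont] continuous_on_subset[OF cont])
    have *: "integrable lborel (\<lambda>x. D i x i)" "(LINT x|lborel. D i x i) = 0" if i: "i \<in> Basis" for i
    proof -
      obtain B where B: "\<And>x. \<bar>D i x i\<bar> \<le> B"
        using continuous_compact_support_bounded[OF Dc[OF i] K'(1) D0] by (metis real_norm_def)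
      have z: "\<psi> i x = 0" if "x \<notin> cball 0 R" for x
        using that K'(3) \<psi>0 by blast
      show "integrable lborel (\<lambda>x. D i x i)" "(LINT x|lborel. D i x i) = 0"
        using integrable_directional_derivative[OF der\<psi> B z] integral_directional_derivative[OF der\<psi> B z]
        by simp_all
    qed
    have eq: "cutoff e x * A x + r e x = (\<Sum>i\<in>Basis. D i x i)" for x
    proof (cases "x \<in> K'")
      case True
      then have "x \<in> ball 0 R - {0}"
        using K' by blast
      then have "(\<Sum>i\<in>Basis. D i x i) = cutoff e x * \<phi> x * d x + cutoff e x * (grad \<phi> x \<bullet> F x)
          + \<phi> x * (cutoff_grad e x \<bullet> F x)"
        by (simp add: D_def sum.distrib div sum_distrib_left euclidean_inner[of _ "F x"] mult.assoc)
      then show ?thesis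
        by (simp add: A_def r_def inner_commute algebra_simps)
    next
      case False
      have "cutoff e x * A x + r e x = (cutoff e x * \<phi> x) * d x + (cutoff e x *\<^sub>R grad \<phi> x) \<bullet> F x
          + (\<phi> x *\<^sub>R cutoff_grad e x) \<bullet> F x"
        by (simp add: A_def r_def inner_commute algebra_simps)
      then show ?thesis
        using False out[OF False] by (simp add: D0)
    qed
    have I: "integrable lborel (\<lambda>x. cutoff e x * A x + r e x)"
      "(LINT x|lborel. cutoff e x * A x + r e x) = 0"
      unfolding eq using * by (simp_all add: Bochner_Integration.integral_sum)
    have "(\<lambda>x. cutoff e x * A x + r e x) \<in> borel_measurable lborel"
      using I(1) by simp
    then show "integrable lebesgue (\<lambda>x. cutoff e x * A x + r e x)"
      "(LINT x|lebesgue. cutoff e x * A x + r e x) = 0"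
      using I by (simp_all add: integrable_completion integral_completion)
  qed
  have full: "(LINT x:ball 0 R|lebesgue. A x) = (LINT x|lebesgue. A x)"
    "integrable lebesgue A"
  proof -
    have "(\<lambda>x. indicat_real (ball 0 R) x *\<^sub>R A x) = A"
    proof
      fix x
      show "indicat_real (ball 0 R) x *\<^sub>R A x = A x"
      proof (cases "x \<in> ball 0 R")
        case False
        then have "A x = 0"
          using A0 K(2) by blast
        then show ?thesis by simp
      qed simp
    qed
    then show "(LINT x:ball 0 R|lebesgue. A x) = (LINT x|lebesgue. A x)" "integrable lebesgue A"
      using Ai by (simp_all only: set_lebesgue_integral_def set_integrable_def)
  qed
  define \<epsilon> where "\<epsilon> k = 1 / real (Suc k)" for k
  have \<epsilon>: "0 < \<epsilon> k" for k
    by (simp add: \<epsilon>_def)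
  have \<epsilon>lim: "\<epsilon> \<longlonglongrightarrow> 0"
    unfolding \<epsilon>_def by (rule LIMSEQ_Suc[OF lim_1_over_n])
  have cm: "(cutoff e :: 'a \<Rightarrow> real) \<in> borel_measurable lebesgue" for e :: real
    by (rule measurable_completion) (simp add: borel_measurable_continuous_onI continuous_on_cutoff)
  have Am: "A \<in> borel_measurable lebesgue"
    using full(2) by simp
  have le: "norm (cutoff e x * A x) \<le> \<bar>A x\<bar>" for e x
    using cutoff_bounds[of e x] by (simp add: abs_mult mult_left_le_one_le)
  have icut: "integrable lebesgue (\<lambda>x. cutoff e x * A x)" for e
    by (rule Bochner_Integration.integrable_bound[OF full(2)])
      (use cm Am le in \<open>auto intro!: AE_I2\<close>)
  have lim1: "(\<lambda>k. LINT x|lebesgue. cutoff (\<epsilon> k) x * A x) \<longlonglongrightarrow> (LINT x|lebesgue. A x)"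
  proof (rule integral_dominated_convergence[where w = "\<lambda>x. \<bar>A x\<bar>"])
    show "integrable lebesgue (\<lambda>x. \<bar>A x\<bar>)"
      using full(2) by simp
    show "AE x in lebesgue. norm (cutoff (\<epsilon> k) x * A x) \<le> \<bar>A x\<bar>" for k
      by (rule AE_I2) (rule le)
    have "(\<lambda>k. cutoff (\<epsilon> k) x * A x) \<longlonglongrightarrow> A x" if "x \<noteq> 0" for x
    proof (rule tendsto_eventually)
      have "eventually (\<lambda>k. \<epsilon> k < norm x / 2) sequentially"
        using \<epsilon>lim that by (intro order_tendstoD) auto
      then show "eventually (\<lambda>k. cutoff (\<epsilon> k) x * A x = A x) sequentially"
      proof eventually_elim
        case (elim k)
        then show ?case
          using cutoff_eq_1[OF \<epsilon>, of k x] by simp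
      qed
    qed
    then have "{x. \<not> (\<lambda>k. cutoff (\<epsilon> k) x * A x) \<longlonglongrightarrow> A x} \<subseteq> {0}"
      by auto
    then show "AE x in lebesgue. (\<lambda>k. cutoff (\<epsilon> k) x * A x) \<longlonglongrightarrow> A x"
      by (intro AE_I'[of "{0}"]) auto
  qed (use cm Am in measurable)
  have lim2: "(\<lambda>k. LINT x|lebesgue. cutoff (\<epsilon> k) x * A x) \<longlonglongrightarrow> 0"
  proof (rule tendstoI)
    fix a :: real assume "a > 0"
    \<comment> \<open>\<open>c\<close> - 1 collects the constants of the shell estimate: 16 from the
      cutoff gradient, M from \<open>\<phi>\<close>, the rest from the volume of the ball of radius
      2 e. The added 1 makes \<open>c\<close> positive and the final bound a (c - 1) / c strictly
      below a.\<close>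
    define c where "c = 16 * M * 2 ^ DIM('a) * unit_ball_vol (real DIM('a)) + 1"
    have c: "c > 0"
      using M(1) by (auto simp: c_def intro!: add_nonneg_pos)
    have "0 < a / c"
      using \<open>a > 0\<close> c by simp
    then obtain \<rho> where \<rho>: "\<rho> > 0"
      "\<forall>x. x \<noteq> 0 \<and> dist x 0 < \<rho> \<longrightarrow> dist (norm x ^ (DIM('a) - 1) * norm (F x)) 0 < a / c"
      using lim unfolding LIM_def by blast
    have "eventually (\<lambda>k. \<epsilon> k < \<rho> / 2) sequentially"
      using \<epsilon>lim \<rho>(1) by (intro order_tendstoD) auto
    then show "eventually (\<lambda>k. dist (LINT x|lebesgue. cutoff (\<epsilon> k) x * A x) 0 < a) sequentially"
    proof eventually_elim
      case (elim k)
      let ?e = "\<epsilon> k" and ?n = "DIM('a)"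
      have e: "?e > 0" by (rule \<epsilon>)
      have "integrable lebesgue (\<lambda>x. (cutoff ?e x * A x + r ?e x) - cutoff ?e x * A x)"
        by (intro Bochner_Integration.integrable_diff main(1)[OF e] icut)
      then have ri: "integrable lebesgue (r ?e)"
        by simp
      have "(LINT x|lebesgue. cutoff ?e x * A x) = - (LINT x|lebesgue. r ?e x)"
        using main(2)[OF e] icut[of ?e] ri by simp
      then have "\<bar>LINT x|lebesgue. cutoff ?e x * A x\<bar> \<le> (LINT x|lebesgue. norm (r ?e x))"
        using integral_norm_bound[of lebesgue "r ?e"] by simp
      also have "\<dots> \<le> (LINT x::'a|lebesgue. (M * (a / c / ?e ^ (?n - 1) * (16 / ?e))) * indicat_real (cball 0 (2 * ?e)) x)"
      proof (rule Bochner_Integration.integral_mono)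
        show "integrable lebesgue (\<lambda>x. norm (r ?e x))"
          using ri by simp
        show "integrable lebesgue (\<lambda>x::'a. (M * (a / c / ?e ^ (?n - 1) * (16 / ?e))) * indicat_real (cball 0 (2 * ?e)) x)"
          by (intro integrable_mult_right integrable_real_indicator)
            (auto simp: emeasure_bounded_finite[OF bounded_cball, unfolded infinity_ennreal_def])
        fix x :: 'a
        show "norm (r ?e x) \<le> (M * (a / c / ?e ^ (?n - 1) * (16 / ?e))) * indicat_real (cball 0 (2 * ?e)) x"
        proof (cases "norm x \<le> ?e \<or> 2 * ?e \<le> norm x")
          case True
          then have "r ?e x = 0"
            using cutoff_grad_eq_0[OF e True] by (simp add: r_def)
          then show ?thesis
            using M(1) \<open>a > 0\<close> c e by simp
        next
          case False
          then have x: "x \<noteq> 0" "norm x < \<rho>" "?e \<le> norm x" "norm x \<le> 2 * ?e"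
            using elim e by auto
          have "?e ^ (?n - 1) * norm (F x) \<le> norm x ^ (?n - 1) * norm (F x)"
            using x e by (intro mult_right_mono power_mono) auto
          also have "\<dots> \<le> a / c"
            using \<rho>(2)[rule_format, of x] x by simp
          finally have F: "norm (F x) \<le> a / c / ?e ^ (?n - 1)"
            by (subst pos_le_divide_eq) (use e in \<open>simp_all add: mult.commute\<close>)
          have "norm (r ?e x) \<le> M * (norm (F x) * norm (cutoff_grad ?e x))"
            unfolding r_def norm_mult using M
            by (intro mult_mono) (auto simp: Cauchy_Schwarz_ineq2)
          also have "\<dots> \<le> M * (a / c / ?e ^ (?n - 1) * (16 / ?e))"
            using M(1) F norm_cutoff_grad[OF e, of x] \<open>a > 0\<close> c e
            by (intro mult_left_mono mult_mono) auto
          finally show ?thesis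
            using x by simp
        qed
      qed
      also have "\<dots> = M * (a / c / ?e ^ (?n - 1) * (16 / ?e)) * (unit_ball_vol (real ?n) * (2 * ?e) ^ ?n)"
        using e by (simp add: content_cball)
      also have "\<dots> = a / c * (c - 1)"
      proof -
        have "?e ^ ?n = ?e * ?e ^ (?n - 1)"
          by (metis DIM_positive Suc_diff_1 power_Suc)
        moreover have "c - 1 = 16 * M * 2 ^ ?n * unit_ball_vol (real ?n)"
          by (simp add: c_def)
        ultimately show ?thesis
          using e by (simp add: power_mult_distrib)
      qed
      also have "\<dots> < a"
        using c \<open>a > 0\<close> by (simp add: field_simps)
      finally show ?case
        by simp
    qed
  qed
  have "(LINT x:ball 0 R|lebesgue. A x) = 0"
    using LIMSEQ_unique[OF lim1 lim2] full(1) by simp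
  then show ?thesis
    unfolding A_def using set_integral_add(2)[OF i1 i2] by simp
qed

section \<open>Logarithmic weights and radial fields\<close>

lemma norm_shell:
  fixes r :: real
  assumes "0 < r" "r < 1"
  obtains k where "(1/2) ^ Suc k \<le> r" "r < (1/2) ^ k"
proof -
  define P where "P m \<longleftrightarrow> (1/2) ^ m \<le> r" for m :: nat
  have "\<exists>m. P m"
    using real_arch_pow_inv[of r "1/2"] assms by (auto simp: P_def intro: less_imp_le)
  then have L: "P (LEAST m. P m)"
    by (rule LeastI_ex)
  moreover have "(LEAST m. P m) \<noteq> 0"
    using L assms by (intro notI) (simp add: P_def)
  ultimately obtain k where k: "(LEAST m. P m) = Suc k"
    using not0_implies_Suc by blast
  have "\<not> P k"
    by (rule not_less_Least) (simp add: k)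
  with L k show ?thesis
    by (intro that[of k]) (auto simp: P_def)
qed

text \<open>On the shell $2^{-k-1} \le |x| < 2^{-k}$ the integral is $O((k+1)^{-s})$.\<close>

lemma absolutely_integrable_log_weight:
  fixes s :: real
  assumes "1 < s"
  shows "(\<lambda>x::'a::euclidean_space. 1 / (norm x ^ DIM('a) * (1 - ln (norm x)) powr s))
    absolutely_integrable_on ball 0 1"
proof -
  let ?N = "DIM('a)"
  define W where "W x = 1 / (norm x ^ ?N * (1 - ln (norm x)) powr s)" for x :: 'a
  define c where "c k = 2 ^ (Suc k * ?N) / (ln 2 * real (Suc k)) powr s" for k
  \<comment> \<open>\<open>c k\<close> bounds the weight on the k-th shell. The shell is enlarged to
    the full ball, which costs only a constant factor and has an explicit volume.\<close>
  define B where "B k = cball (0::'a) ((1/2) ^ k)" for k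
  define b where "b k = unit_ball_vol (real ?N) * 2 ^ ?N * (ln 2 powr (- s) * real (Suc k) powr (- s))" for k
  have Wm: "(\<lambda>x. indicat_real (ball 0 1) x *\<^sub>R W x) \<in> borel_measurable borel"
  proof (intro borel_measurable_scaleR borel_measurable_indicator)
    show "W \<in> borel_measurable borel"
      unfolding W_def by measurable
  qed simp
  have [measurable]: "B k \<in> sets borel" for k
    by (simp add: B_def borel_closed)
  have c0: "0 \<le> c k" for k
    by (simp add: c_def)
  have b0: "0 \<le> b k" for k
    by (simp add: b_def)
  have bsum: "summable b"
  proof -
    have "summable (\<lambda>k. real k powr (- s))"
      using assms by (simp add: summable_real_powr_iff)
    then have "summable (\<lambda>k. real (Suc k) powr (- s))"
      by (rule summable_Suc_iff[THEN iffD2, where f1 = "\<lambda>k. real k powr (- s)"])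
    then show ?thesis
      unfolding b_def[abs_def] by (intro summable_mult)
  qed
  have W0: "0 \<le> W x" for x
    by (simp add: W_def)
  have bound: "ennreal (indicat_real (ball 0 1) x *\<^sub>R W x) \<le> (\<Sum>k. ennreal (c k) * indicator (B k) x)" for x
  proof (cases "x = 0 \<or> x \<notin> ball 0 1")
    \<comment> \<open>At the origin the weight is 1/0 = 0 by convention, so the bound holds at every
      point.\<close>
    case True
    then have "indicat_real (ball 0 1) x *\<^sub>R W x = 0"
      by (auto simp: W_def)
    then show ?thesis
      by (simp only: ennreal_0 zero_le)
  next
    case False
    then have x: "0 < norm x" "norm x < 1" "x \<in> ball 0 1"
      by auto
    obtain k where k: "(1/2) ^ Suc k \<le> norm x" "norm x < (1/2) ^ k"
      using norm_shell[OF x(1,2)] by metis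
    have "ln (norm x) \<le> ln ((1/2) ^ k)"
      using k x by (subst ln_le_cancel_iff) auto
    also have "\<dots> = - (real k * ln 2)"
      by (simp add: ln_realpow ln_div)
    \<comment> \<open>The shell gives only 1 + k ln 2 \<le> 1 - ln |x|; the summand 1 exceeds ln 2
      and so supplies the shift from k to k + 1, which keeps the base positive at k = 0.\<close>
    finally have "ln 2 * real (Suc k) \<le> 1 - ln (norm x)"
      using ln_2_less_1 by (simp add: algebra_simps)
    then have 1: "(ln 2 * real (Suc k)) powr s \<le> (1 - ln (norm x)) powr s"
      using assms by (intro powr_mono2) auto
    have "((1/2) ^ Suc k) ^ ?N \<le> norm x ^ ?N"
      using k by (intro power_mono) auto
    then have "((1/2) ^ Suc k) ^ ?N * (ln 2 * real (Suc k)) powr s \<le> norm x ^ ?N * (1 - ln (norm x)) powr s"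
      using 1 by (intro mult_mono) auto
    moreover have "0 < (1 - ln (norm x)) powr s"
      unfolding powr_gt_zero using ln_less_zero[OF x(1,2)] by linarith
    ultimately have "W x \<le> 1 / (((1/2) ^ Suc k) ^ ?N * (ln 2 * real (Suc k)) powr s)"
      unfolding W_def using x by (intro divide_left_mono mult_pos_pos) auto
    also have "\<dots> = c k"
      by (simp add: c_def power_mult[symmetric] power_one_over power_add)
    finally have "W x \<le> c k" .
    then have "ennreal (indicat_real (ball 0 1) x *\<^sub>R W x) \<le> ennreal (c k) * indicator (B k) x"
      using k x by (simp add: B_def ennreal_leI)
    also have "\<dots> = (\<Sum>j\<in>{k}. ennreal (c j) * indicator (B j) x)"
      by (simp only: sum.insert finite.emptyI empty_iff sum.empty add_0_right simp_thms)
    also have "\<dots> \<le> (\<Sum>k. ennreal (c k) * indicator (B k) x)"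
      by (intro sum_le_suminf) auto
    finally show ?thesis .
  qed
  have eq: "(\<integral>\<^sup>+x. ennreal (c k) * indicator (B k) x \<partial>lborel) = ennreal (b k)" for k
  proof -
    have "emeasure lborel (B k) = ennreal (measure lborel (B k))"
      unfolding B_def by (intro emeasure_eq_ennreal_measure)
        (metis bounded_cball emeasure_bounded_finite infinity_ennreal_def less_irrefl)
    then have "(\<integral>\<^sup>+x. ennreal (c k) * indicator (B k) x \<partial>lborel) = ennreal (c k * measure lborel (B k))"
      by (simp add: nn_integral_cmult_indicator B_def ennreal_mult c0)
    also have "c k * measure lborel (B k) = b k"
    proof -
      have "c k * measure lborel (B k) = unit_ball_vol (real ?N) * (2 ^ (Suc k * ?N) * ((1/2) ^ k) ^ ?N) / (ln 2 * real (Suc k)) powr s"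
        by (simp add: c_def B_def content_cball)
      also have "2 ^ (Suc k * ?N) * ((1/2) ^ k) ^ ?N = (2::real) ^ ?N"
        by (simp add: power_mult[symmetric] power_one_over power_add)
      also have "unit_ball_vol (real ?N) * 2 ^ ?N / (ln 2 * real (Suc k)) powr s = b k"
        by (simp add: b_def powr_mult powr_minus divide_inverse)
      finally show ?thesis .
    qed
    finally show ?thesis .
  qed
  have "(\<integral>\<^sup>+x. ennreal (indicat_real (ball 0 1) x *\<^sub>R W x) \<partial>lborel)
      \<le> (\<integral>\<^sup>+x. (\<Sum>k. ennreal (c k) * indicator (B k) x) \<partial>lborel)"
    by (intro nn_integral_mono bound)
  also have "\<dots> = (\<Sum>k. \<integral>\<^sup>+x. ennreal (c k) * indicator (B k) x \<partial>lborel)"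
    by (rule nn_integral_suminf) measurable
  also have "\<dots> = (\<Sum>k. ennreal (b k))"
    by (simp add: eq)
  also have "\<dots> < \<infinity>"
    using ennreal_suminf_neq_top[OF bsum b0] by (simp add: less_top)
  finally have "integrable lborel (\<lambda>x. indicat_real (ball 0 1) x *\<^sub>R W x)"
    using Wm W0 by (intro integrableI_nonneg) auto
  then show ?thesis
    unfolding set_integrable_def W_def using Wm[unfolded W_def]
    by (simp add: integrable_completion)
qed

text \<open>Apply ln y \<le> y - 1 at y = r^{-1/p}, whose p-th power is 1/r. Thus any power of the
  logarithm can be traded for a single factor 1/r.\<close>

lemma powr_log_le:
  fixes p r :: real
  assumes "0 < p" "0 < r" "r < 1"
  shows "(1 - ln r) powr p \<le> (1 + p) powr p / r"
proof -
  define y where "y = r powr (- 1 / p)"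
  have y: "1 \<le> y"
    using assms powr_mono'[of "-1/p" 0 r] by (simp add: y_def)
  have "ln r = - p * ln y"
    using assms by (simp add: y_def ln_powr)
  moreover have "p * ln y \<le> p * y"
    using assms(1) ln_le_minus_one[of y] y by (intro mult_left_mono) auto
  ultimately have "1 - ln r \<le> (1 + p) * y"
    using y by (simp add: algebra_simps)
  moreover have "0 \<le> 1 - ln r"
    using assms ln_less_zero[of r] by linarith
  ultimately have "(1 - ln r) powr p \<le> ((1 + p) * y) powr p"
    using assms by (intro powr_mono2) auto
  also have "\<dots> = (1 + p) powr p * y powr p"
    using assms y by (simp add: powr_mult)
  also have "y powr p = 1 / r"
    unfolding y_def powr_powr using assms by (simp add: powr_minus_divide)
  also have "(1 + p) powr p * (1 / r) = (1 + p) powr p / r"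
    by simp
  finally show ?thesis .
qed

text \<open>Continuity off the origin gives measurability there, and one point is negligible, so the
  value that a singular formula takes at 0 by convention has no influence.\<close>

lemma absolutely_integrable_punctured_ball:
  fixes h :: "'a::euclidean_space \<Rightarrow> 'b::euclidean_space"
  assumes "continuous_on (ball 0 R - {0}) h" "g absolutely_integrable_on ball 0 R"
    and bound: "\<And>x. x \<in> ball 0 R - {0} \<Longrightarrow> norm (h x) \<le> g x"
  shows "h absolutely_integrable_on ball 0 R"
proof -
  have S: "ball (0::'a) R - {0} \<in> sets lebesgue"
    by simp
  have "h \<in> borel_measurable (lebesgue_on (ball 0 R - {0}))"
    using assms(1) S by (rule continuous_imp_measurable_on_sets_lebesgue)
  moreover have "g absolutely_integrable_on (ball 0 R - {0})"
    using assms(2) S by (rule set_integrable_subset) auto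
  ultimately have "h absolutely_integrable_on (ball 0 R - {0})"
    using S bound set_lebesgue_integral_eq_integral(1)
    by (intro measurable_bounded_by_integrable_imp_absolutely_integrable[of h _ g]) auto
  moreover have "negligible {x \<in> ball (0::'a) R - {0} - ball 0 R. h x \<noteq> 0}"
    "negligible {x \<in> ball (0::'a) R - (ball 0 R - {0}). h x \<noteq> 0}"
    by (rule negligible_subset[of "{0}"]; auto)+
  ultimately show ?thesis
    by (rule absolutely_integrable_spike_set)
qed

text \<open>The bound is better than |x|^{-N} by one factor |x|, and that factor absorbs the
  logarithmic power q + 2. What remains is dominated by the logarithmic weight with exponent 2, a
  convenient value above 1.\<close>

lemma absolutely_integrable_log_bound:
  fixes h :: "'a::euclidean_space \<Rightarrow> 'b::euclidean_space"
  assumes "continuous_on (ball 0 R - {0}) h" "R \<le> 1" "0 \<le> q"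
    and bound: "\<And>x. x \<in> ball 0 R - {0} \<Longrightarrow> norm x ^ (DIM('a) - 1) * norm (h x) \<le> B * (1 - ln (norm x)) powr q"
  shows "h absolutely_integrable_on ball 0 R"
proof -
  let ?W = "\<lambda>x::'a. 1 / (norm x ^ DIM('a) * (1 - ln (norm x)) powr 2)"
  define C where "C = \<bar>B\<bar> * (1 + (q + 2)) powr (q + 2)"
  have "?W absolutely_integrable_on ball 0 R"
    using absolutely_integrable_log_weight[of 2]
    by (rule set_integrable_subset) (use assms(2) in auto)
  then have i: "(\<lambda>x. C * ?W x) absolutely_integrable_on ball 0 R"
    by (rule set_integrable_mult_right)
  show ?thesis
  proof (rule absolutely_integrable_punctured_ball[OF assms(1) i])
    fix x :: 'a assume x: "x \<in> ball 0 R - {0}"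
    define r where "r = norm x"
    have r: "0 < r" "r < 1"
      using x assms(2) by (auto simp: r_def)
    have l: "1 \<le> 1 - ln r"
      using r by simp
    have rN: "r ^ DIM('a) = r * r ^ (DIM('a) - 1)"
      by (metis DIM_positive Suc_diff_1 power_Suc)
    have "norm (h x) * (r ^ DIM('a) * (1 - ln r) powr 2) = r * (1 - ln r) powr 2 * (r ^ (DIM('a) - 1) * norm (h x))"
      by (simp add: rN)
    also have "\<dots> \<le> r * (1 - ln r) powr 2 * (\<bar>B\<bar> * (1 - ln r) powr q)"
    proof (rule mult_left_mono)
      have "B * (1 - ln r) powr q \<le> \<bar>B\<bar> * (1 - ln r) powr q"
        by (rule mult_right_mono) auto
      then show "r ^ (DIM('a) - 1) * norm (h x) \<le> \<bar>B\<bar> * (1 - ln r) powr q"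
        using bound[OF x] unfolding r_def by linarith
    qed (use r in auto)
    also have "\<dots> = \<bar>B\<bar> * (r * (1 - ln r) powr (q + 2))"
      by (simp add: powr_add)
    also have "\<dots> \<le> C"
    proof -
      have "r * (1 - ln r) powr (q + 2) \<le> (1 + (q + 2)) powr (q + 2)"
        using powr_log_le[of "q + 2" r] r assms(3) by (simp add: field_simps)
      then show ?thesis
        unfolding C_def by (intro mult_left_mono) auto
    qed
    finally have "norm (h x) * (r ^ DIM('a) * (1 - ln r) powr 2) \<le> C" .
    moreover have "0 < (1 - ln r) powr 2"
      unfolding powr_gt_zero using l by linarith
    then have "0 < r ^ DIM('a) * (1 - ln r) powr 2"
      using r by (intro mult_pos_pos) auto
    ultimately show "norm (h x) \<le> C * (1 / (norm x ^ DIM('a) * (1 - ln (norm x)) powr 2))"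
      unfolding r_def[symmetric] times_divide_eq_right mult_1_right by (simp only: pos_le_divide_eq)
  qed
qed

section \<open>Radial functions and radial vector fields\<close>

lemma filterlim_norm_at_0: "filterlim (norm :: 'a::real_normed_vector \<Rightarrow> real) (at_right 0) (at 0)"
proof -
  have "(norm \<longlongrightarrow> (0::real)) (at (0::'a))"
    by (rule tendsto_norm_zero) (rule tendsto_ident_at)
  moreover have "eventually (\<lambda>x::'a. norm x \<in> {0<..} \<and> norm x \<noteq> 0) (at 0)"
    by (auto simp: eventually_at_filter)
  ultimately show ?thesis
    by (simp add: filterlim_at)
qed

lemma continuous_on_radial:
  assumes "continuous_on {0<..<R} q"
  shows "continuous_on (ball 0 R - {0}) (\<lambda>x::'a::real_normed_vector. q (norm x))"
  by (rule continuous_on_compose2[OF assms]) (auto intro!: continuous_intros)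

lemma has_derivative_radial:
  fixes x :: "'a::euclidean_space"
  assumes "(q has_real_derivative c) (at (norm x))" "x \<noteq> 0"
  shows "((\<lambda>x. q (norm x)) has_derivative (\<lambda>h. ((c / norm x) *\<^sub>R x) \<bullet> h)) (at x)"
proof -
  have "(norm has_derivative (\<lambda>h. h \<bullet> sgn x)) (at x)"
    using assms(2) by (rule has_derivative_norm)
  then have "((\<lambda>x. q (norm x)) has_derivative (\<lambda>h. c * (h \<bullet> sgn x))) (at x)"
    using assms(1) unfolding has_field_derivative_def by (rule has_derivative_compose)
  moreover have "(\<lambda>h. c * (h \<bullet> sgn x)) = (\<lambda>h. ((c / norm x) *\<^sub>R x) \<bullet> h)"
    by (simp add: fun_eq_iff sgn_div_norm inner_commute divide_inverse)
  ultimately show ?thesis by simp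
qed

text \<open>Here q is the flux through the sphere of radius r divided by the area of the unit
  sphere. Writing the field as A(|x|) x with A = q / r^N, the trace of its derivative is N A + r A'
  = q' / r^{N-1}. Moreover |x|^{N-1} times the norm of the field is |q|, so q -> 0 is exactly the
  condition that excludes a point mass.\<close>

theorem radial_field_divergence:
  fixes d :: "'a::euclidean_space \<Rightarrow> real"
  assumes der: "\<And>r. 0 < r \<Longrightarrow> r < R \<Longrightarrow> (q has_real_derivative q' r) (at r)"
    and cont: "continuous_on {0<..<R} q'"
    and lim: "(q \<longlongrightarrow> 0) (at_right 0)"
    and int: "(\<lambda>x::'a. (q (norm x) / norm x ^ DIM('a)) *\<^sub>R x) absolutely_integrable_on ball 0 R"
    and d: "\<And>x. x \<in> ball 0 R - {0} \<Longrightarrow> d x = q' (norm x) / norm x ^ (DIM('a) - 1)"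
    and dint: "d absolutely_integrable_on ball 0 R"
    and test: "test_fun (ball 0 R) \<phi>"
  shows "(LINT x:ball 0 R|lebesgue. ((q (norm x) / norm x ^ DIM('a)) *\<^sub>R x) \<bullet> grad \<phi> x) =
    - (LINT x:ball 0 R|lebesgue. d x * \<phi> x)"
proof -
  let ?N = "DIM('a)"
  define A where "A r = q r / r ^ ?N" for r
  define A' where "A' r = q' r / r ^ ?N - real ?N * q r / (r * r ^ ?N)" for r
  define F' where "F' x h = A (norm x) *\<^sub>R h + (A' (norm x) * (x \<bullet> h) / norm x) *\<^sub>R x" for x h :: 'a
  have rN: "r ^ ?N = r * r ^ (?N - 1)" for r :: real
    by (metis DIM_positive Suc_diff_1 power_Suc)
  have qc: "continuous_on {0<..<R} q"
    using der by (intro continuous_at_imp_continuous_on ballI DERIV_isCont) auto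
  have derA: "(A has_real_derivative A' r) (at r)" if r: "0 < r" "r < R" for r
  proof -
    have "(A has_real_derivative (q' r * r ^ ?N - q r * (real ?N * r ^ (?N - 1))) / (r ^ ?N * r ^ ?N)) (at r)"
      unfolding A_def[abs_def] using r
      by (auto intro!: derivative_eq_intros der)
    moreover have "(q' r * r ^ ?N - q r * (real ?N * r ^ (?N - 1))) / (r ^ ?N * r ^ ?N) = A' r"
      using r by (simp add: A'_def rN field_simps)
    ultimately show ?thesis by simp
  qed
  have derF: "((\<lambda>x. A (norm x) *\<^sub>R x) has_derivative F' x) (at x)" if x: "x \<in> ball 0 R - {0}" for x
  proof -
    have "((\<lambda>x. A (norm x)) has_derivative (\<lambda>h. ((A' (norm x) / norm x) *\<^sub>R x) \<bullet> h)) (at x)"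
      using x by (intro has_derivative_radial derA) auto
    then show ?thesis
      by (rule derivative_eq_intros refl)+ (auto simp: F'_def fun_eq_iff intro: has_derivative_ident)
  qed
  have "(LINT x:ball 0 R|lebesgue. (A (norm x) *\<^sub>R x) \<bullet> grad \<phi> x) = - (LINT x:ball 0 R|lebesgue. d x * \<phi> x)"
  proof (rule divergence_removable_singularity[OF derF _ _ _ dint _ test])
    show "(\<lambda>x::'a. A (norm x) *\<^sub>R x) absolutely_integrable_on ball 0 R"
      using int by (simp add: A_def)
    show "continuous_on (ball 0 R - {0}) (\<lambda>x. F' x i \<bullet> i)" for i
      unfolding F'_def A_def A'_def
      by (intro continuous_intros continuous_on_radial qc cont) auto
    show "d x = (\<Sum>i\<in>Basis. F' x i \<bullet> i)" if x: "x \<in> ball 0 R - {0}" for x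
    proof -
      define r where "r = norm x"
      have r: "r > 0"
        using x by (simp add: r_def)
      have "(\<Sum>i\<in>Basis. F' x i \<bullet> i) = real ?N * A r + A' r / r * (\<Sum>i\<in>Basis. (x \<bullet> i) * (x \<bullet> i))"
        by (simp add: F'_def inner_add_left sum.distrib r_def sum_distrib_left mult.assoc)
      also have "\<dots> = real ?N * A r + A' r / r * (x \<bullet> x)"
        by (simp only: euclidean_inner[of x x])
      also have "\<dots> = real ?N * A r + A' r * r"
        using r by (simp add: r_def dot_square_norm power2_eq_square)
      also have "\<dots> = q' r / r ^ (?N - 1)"
        using r by (simp add: A_def A'_def rN field_simps)
      finally show ?thesis
        using d[OF x] by (simp add: r_def)
    qed
    have eq: "norm x ^ (?N - 1) * norm (A (norm x) *\<^sub>R x) = \<bar>q (norm x)\<bar>" if "x \<noteq> 0" for x :: 'a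
      using that by (simp add: A_def rN[of "norm x"])
    have "((\<lambda>x::'a. \<bar>q (norm x)\<bar>) \<longlongrightarrow> 0) (at 0)"
      using filterlim_compose[OF lim filterlim_norm_at_0] by (rule tendsto_rabs_zero)
    then show "((\<lambda>x::'a. norm x ^ (?N - 1) * norm (A (norm x) *\<^sub>R x)) \<longlongrightarrow> 0) (at 0)"
      by (rule Lim_transform_eventually, unfold eventually_at_filter)
        (intro always_eventually allI impI eq[symmetric])
  qed
  then show ?thesis
    by (simp add: A_def)
qed

lemma L1_loc_absolutely_integrable:
  "h absolutely_integrable_on S \<Longrightarrow> L1_loc S h"
  unfolding L1_loc_def by (blast intro: set_integrable_subset lmeasurable_compact fmeasurableD)

text \<open>The identity for direction i is the divergence identity for the field v(|x|) i, whose
  divergence is the i-th partial derivative. Its condition at the origin reduces to r^{N-1} v(r) ->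
  0.\<close>

theorem weak_gradient_radial:
  fixes v v' :: "real \<Rightarrow> real"
  assumes der: "\<And>r. 0 < r \<Longrightarrow> r < R \<Longrightarrow> (v has_real_derivative v' r) (at r)"
    and cont: "continuous_on {0<..<R} v'"
    and lim: "((\<lambda>r. r ^ (DIM('a) - 1) * v r) \<longlongrightarrow> 0) (at_right 0)"
    and vint: "(\<lambda>x::'a::euclidean_space. v (norm x)) absolutely_integrable_on ball 0 R"
    and gint: "(\<lambda>x::'a. (v' (norm x) / norm x) *\<^sub>R x) absolutely_integrable_on ball 0 R"
  shows "weak_gradient (ball 0 R) (\<lambda>x::'a. v (norm x)) (\<lambda>x. (v' (norm x) / norm x) *\<^sub>R x)"
  unfolding weak_gradient_def
proof (intro conjI allI impI ballI)
  show "L1_loc (ball 0 R) (\<lambda>x::'a. v (norm x))" "L1_loc (ball 0 R) (\<lambda>x::'a. (v' (norm x) / norm x) *\<^sub>R x)"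
    using vint gint by (auto intro: L1_loc_absolutely_integrable)
  fix \<phi> :: "'a \<Rightarrow> real" and i :: 'a
  assume test: "test_fun (ball 0 R) \<phi>" and i: "i \<in> Basis"
  let ?g = "\<lambda>x::'a. (v' (norm x) / norm x) *\<^sub>R x"
  have der': "((\<lambda>x. v (norm x) *\<^sub>R i) has_derivative (\<lambda>h. (?g x \<bullet> h) *\<^sub>R i)) (at x)"
    if x: "x \<in> ball 0 R - {0}" for x
  proof -
    have "((\<lambda>x. v (norm x)) has_derivative (\<lambda>h. ?g x \<bullet> h)) (at x)"
      using x by (intro has_derivative_radial der) auto
    then show ?thesis
      by (rule has_derivative_scaleR_left)
  qed
  have "(LINT x:ball 0 R|lebesgue. (v (norm x) *\<^sub>R i) \<bullet> grad \<phi> x) =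
      - (LINT x:ball 0 R|lebesgue. (?g x \<bullet> i) * \<phi> x)"
  proof (rule divergence_removable_singularity[OF der' _ _ _ _ _ test])
    show "continuous_on (ball 0 R - {0}) (\<lambda>x. ((?g x \<bullet> j) *\<^sub>R i) \<bullet> j)" for j
      by (intro continuous_intros continuous_on_radial cont) auto
    show "?g x \<bullet> i = (\<Sum>j\<in>Basis. ((?g x \<bullet> j) *\<^sub>R i) \<bullet> j)" for x
      by (simp only: inner_scaleR_left[of "?g x \<bullet> j" for j] euclidean_inner[of "?g x" i])
    show "(\<lambda>x::'a. v (norm x) *\<^sub>R i) absolutely_integrable_on ball 0 R"
      using absolutely_integrable_linear[OF vint bounded_linear_scaleR_left[of i]] by (simp add: o_def)
    show "(\<lambda>x. ?g x \<bullet> i) absolutely_integrable_on ball 0 R"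
      using absolutely_integrable_linear[OF gint bounded_linear_inner_left[of i]] by (simp add: o_def)
    have "((\<lambda>x::'a. \<bar>norm x ^ (DIM('a) - 1) * v (norm x)\<bar>) \<longlongrightarrow> 0) (at 0)"
      using filterlim_compose[OF lim filterlim_norm_at_0] by (rule tendsto_rabs_zero)
    then show "((\<lambda>x::'a. norm x ^ (DIM('a) - 1) * norm (v (norm x) *\<^sub>R i)) \<longlongrightarrow> 0) (at 0)"
      using i by (simp add: abs_mult)
  qed
  then show "(LINT x:ball 0 R|lebesgue. v (norm x) * (grad \<phi> x \<bullet> i)) =
      - (LINT x:ball 0 R|lebesgue. (?g x \<bullet> i) * \<phi> x)"
    by (simp add: inner_commute)
qed

section \<open>The nonlinearity\<close>

definition growth :: "nat \<Rightarrow> real \<Rightarrow> real \<Rightarrow> real" where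
  "growth N \<mu> t = (real N - 1) * (\<mu> - 1) * (real N / \<mu>) ^ N *
     exp (t powr \<mu> - real N) * t powr (- (1 + real N * (\<mu> - 1)))"

definition threshold :: "nat \<Rightarrow> real \<Rightarrow> real" where
  "threshold N \<mu> = real N powr (1 / \<mu>)"

text \<open>Clamping the argument replaces a case split: monotonicity, continuity and Lipschitz
  bounds of \<open>growth\<close> beyond the threshold pass through \<open>max\<close>.\<close>

definition nonlinearity :: "nat \<Rightarrow> real \<Rightarrow> real \<Rightarrow> real" where
  "nonlinearity N \<mu> t = growth N \<mu> (max t (threshold N \<mu>))"

definition profile :: "nat \<Rightarrow> real \<Rightarrow> real \<Rightarrow> real" where
  "profile N \<mu> r = (real N * (1 - ln r)) powr (1 / \<mu>)"

text \<open>This is -r u'(r) for the profile u. Splitting off 1/r makes the flux r^{N-1} |u'|^{N-2}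
  u' equal to -\<open>slope\<close>^{N-1}, free of explicit powers of r.\<close>

definition slope :: "nat \<Rightarrow> real \<Rightarrow> real \<Rightarrow> real" where
  "slope N \<mu> r = real N / \<mu> * (real N * (1 - ln r)) powr (1 / \<mu> - 1)"

lemma DERIV_exp_powr_times_powr:
  fixes t C c p a :: real
  assumes "0 < t"
  shows "((\<lambda>t. C * exp (t powr p - c) * t powr a) has_real_derivative
    C * exp (t powr p - c) * t powr a * (p * t powr (p - 1) + a / t)) (at t)"
proof -
  have "((\<lambda>t. C * exp (t powr p - c) * t powr a) has_real_derivative
      C * (exp (t powr p - c) * (p * t powr (p - 1))) * t powr a +
      a * t powr (a - 1) * (C * exp (t powr p - c))) (at t)"
    using assms by (auto intro!: derivative_eq_intros)
  also have "t powr (a - 1) = t powr a / t"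
    using assms by (simp add: powr_diff)
  finally show ?thesis
    by (simp add: algebra_simps)
qed

context
  fixes N :: nat and \<mu> :: real
  assumes N: "2 \<le> N" and mu: "1 < \<mu>"
begin

lemma const_pos: "0 < (real N - 1) * (\<mu> - 1) * (real N / \<mu>) ^ N"
  using N mu by simp

lemma threshold_pos: "0 < threshold N \<mu>"
  using N by (simp add: threshold_def)

lemma growth_nonneg: "0 \<le> growth N \<mu> t"
  unfolding growth_def
  by (rule mult_nonneg_nonneg[OF mult_nonneg_nonneg[OF less_imp_le[OF const_pos]]]) auto

lemma nonlinearity_nonneg: "0 \<le> nonlinearity N \<mu> t"
  unfolding nonlinearity_def by (rule growth_nonneg)

lemma DERIV_growth:
  assumes "0 < t"
  shows "(growth N \<mu> has_real_derivative
    growth N \<mu> t * (\<mu> * t powr (\<mu> - 1) - (1 + real N * (\<mu> - 1)) / t)) (at t)"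
  using DERIV_exp_powr_times_powr[OF assms, of _ \<mu> "real N" "- (1 + real N * (\<mu> - 1))"]
  unfolding growth_def[abs_def] by (simp only: minus_divide_left[symmetric] diff_conv_add_uminus)

text \<open>The logarithmic derivative of \<open>growth\<close> is nonnegative exactly when \<mu>
  t^\<mu> \<ge> 1 + N (\<mu> - 1). From the threshold on t^\<mu> \<ge> N, and \<mu> N \<ge> 1 + N
  (\<mu> - 1) just says N \<ge> 1.\<close>

lemma growth_mono:
  assumes "threshold N \<mu> \<le> s" "s \<le> t"
  shows "growth N \<mu> s \<le> growth N \<mu> t"
proof (rule DERIV_nonneg_imp_nondecreasing[OF assms(2)])
  fix x assume "s \<le> x" "x \<le> t"
  then have x: "threshold N \<mu> \<le> x" "0 < x"
    using assms(1) threshold_pos by auto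
  have "real N = threshold N \<mu> powr \<mu>"
    using mu N by (simp add: threshold_def powr_powr)
  also have "\<dots> \<le> x powr \<mu>"
    using x threshold_pos mu by (intro powr_mono2) auto
  finally have "\<mu> * real N \<le> \<mu> * x powr \<mu>"
    using mu by simp
  then have "1 + real N * (\<mu> - 1) \<le> \<mu> * x powr \<mu>"
    using N by (simp add: algebra_simps)
  also have "\<dots> = \<mu> * x powr (\<mu> - 1) * x"
    using x by (simp add: powr_diff)
  finally have "(1 + real N * (\<mu> - 1)) / x \<le> \<mu> * x powr (\<mu> - 1)"
    using x by (simp add: pos_divide_le_eq)
  then show "\<exists>y. (growth N \<mu> has_real_derivative y) (at x) \<and> 0 \<le> y"
    using DERIV_growth[OF x(2)] growth_nonneg by (intro exI conjI mult_nonneg_nonneg) auto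
qed

lemma nonlinearity_mono: "s \<le> t \<Longrightarrow> nonlinearity N \<mu> s \<le> nonlinearity N \<mu> t"
  unfolding nonlinearity_def by (rule growth_mono) auto

lemma eventually_nonlinearity: "eventually (\<lambda>t. nonlinearity N \<mu> t = growth N \<mu> t) at_top"
  using eventually_ge_at_top[of "threshold N \<mu>"]
  by eventually_elim (simp add: nonlinearity_def max_absorb1)

lemma nonlinearity_exp_linear:
  assumes "0 < \<beta>"
  shows "filterlim (\<lambda>t. nonlinearity N \<mu> t * exp (- \<beta> * t)) at_top at_top"
proof -
  have "filterlim (\<lambda>t. growth N \<mu> t * exp (- \<beta> * t)) at_top at_top"
    unfolding growth_def using const_pos mu assms by real_asymp
  then show ?thesis
    by (rule filterlim_mono_eventually[OF _ order_refl order_refl])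
      (use eventually_nonlinearity in eventually_elim, simp)
qed

lemma super_exponential_nonlinearity: "super_exponential (nonlinearity N \<mu>)"
  unfolding super_exponential_def sub_exponential_def
proof (intro notI, elim exE conjE)
  fix \<beta> :: real
  assume \<beta>: "0 < \<beta>" and "bdd_above ((\<lambda>t. nonlinearity N \<mu> t * exp (- \<beta> * t)) ` {0..})"
  then obtain M where M: "\<And>t. 0 \<le> t \<Longrightarrow> nonlinearity N \<mu> t * exp (- \<beta> * t) \<le> M"
    unfolding bdd_above_def by auto
  have "eventually (\<lambda>t. M < nonlinearity N \<mu> t * exp (- \<beta> * t)) at_top"
    using nonlinearity_exp_linear[OF \<beta>] by (simp add: filterlim_at_top_dense)
  moreover have "eventually (\<lambda>t. (0::real) \<le> t) at_top"
    by (rule eventually_ge_at_top)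
  ultimately have "eventually (\<lambda>t::real. False) at_top"
    by eventually_elim (use M in force)
  then show False by simp
qed

lemma nonlinearity_upper: "((\<lambda>t. nonlinearity N \<mu> t * exp (- (t powr \<mu>))) \<longlongrightarrow> 0) at_top"
proof -
  have "0 < 1 + real N * (\<mu> - 1)"
    using mu by (intro add_pos_nonneg) auto
  then have "((\<lambda>t. growth N \<mu> t * exp (- (t powr \<mu>))) \<longlongrightarrow> 0) at_top"
    unfolding growth_def using const_pos mu by real_asymp
  then show ?thesis
    by (rule Lim_transform_eventually) (use eventually_nonlinearity in eventually_elim, simp)
qed

lemma nonlinearity_lower:
  assumes "0 < \<epsilon>"
  shows "filterlim (\<lambda>t. nonlinearity N \<mu> t * exp (- (t powr (\<mu> - \<epsilon>)))) at_top at_top"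
proof -
  \<comment> \<open>The given \<epsilon> may exceed \<mu>; shrinking it keeps the exponent \<mu> - e
    positive. For t \<ge> 1 a smaller e gives a larger t^{\<mu> - e}, hence a stronger
    statement.\<close>
  define e where "e = min \<epsilon> (\<mu> / 2)"
  have e: "0 < e" "e < \<mu>" "e \<le> \<epsilon>"
    using assms mu by (auto simp: e_def)
  have "filterlim (\<lambda>t. growth N \<mu> t * exp (- (t powr (\<mu> - e)))) at_top at_top"
    unfolding growth_def using const_pos mu e(1,2) by real_asymp
  then show ?thesis
  proof (rule filterlim_at_top_mono)
    show "eventually (\<lambda>t. growth N \<mu> t * exp (- (t powr (\<mu> - e))) \<le>
        nonlinearity N \<mu> t * exp (- (t powr (\<mu> - \<epsilon>)))) at_top"
      using eventually_nonlinearity eventually_ge_at_top[of 1]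
    proof eventually_elim
      case (elim t)
      have "t powr (\<mu> - \<epsilon>) \<le> t powr (\<mu> - e)"
        using elim e by (intro powr_mono) auto
      then show ?case
        using elim growth_nonneg[of t] by (simp add: mult_left_mono)
    qed
  qed
qed

text \<open>On bounded sets the function is Lipschitz: \<open>growth\<close> has a bounded
  derivative on compact intervals starting at the threshold, and \<open>max\<close> is 1-Lipschitz.
  As the exponent has to be below 1, one factor sqrt |s - t| is bounded by sqrt T, leaving exponent
  1/2.\<close>

lemma cond_f1_nonlinearity: "cond_f1 (nonlinearity N \<mu>)"
  unfolding cond_f1_def
proof (intro exI[of _ "1/2"] conjI)
  show "locally_holder_on (1/2) {0..} (nonlinearity N \<mu>)"
    unfolding locally_holder_on_def
  proof (intro allI impI, elim conjE)
    fix K :: "real set" assume "compact K" "K \<subseteq> {0..}"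
    then obtain T where T: "\<And>t. t \<in> K \<Longrightarrow> 0 \<le> t \<and> t \<le> T" "0 < T"
      using compact_imp_bounded[of K] unfolding bounded_pos by force
    define I where "I = {threshold N \<mu>..max T (threshold N \<mu>)}"
    define G where "G t = growth N \<mu> t * (\<mu> * t powr (\<mu> - 1) - (1 + real N * (\<mu> - 1)) / t)" for t
    have D: "(growth N \<mu> has_real_derivative G t) (at t)" if "t \<in> I" for t
      using DERIV_growth[of t] that threshold_pos by (simp add: G_def I_def)
    have "continuous_on I (growth N \<mu>)"
      by (intro continuous_at_imp_continuous_on ballI DERIV_isCont[OF D])
    then have "continuous_on I G"
      unfolding G_def using threshold_pos
      by (intro continuous_intros) (auto simp: I_def)
    then have "bounded (G ` I)"
      using compact_continuous_image compact_imp_bounded by (metis I_def compact_Icc)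
    then obtain B where B: "0 < B" "\<And>t. t \<in> I \<Longrightarrow> norm (G t) \<le> B"
      unfolding bounded_pos by auto
    have "\<bar>nonlinearity N \<mu> s - nonlinearity N \<mu> t\<bar> \<le> B * sqrt T * \<bar>s - t\<bar> powr (1/2)"
      if st: "s \<in> K" "t \<in> K" for s t
    proof -
      let ?m = "\<lambda>t. max t (threshold N \<mu>)"
      have "norm (growth N \<mu> (?m s) - growth N \<mu> (?m t)) \<le> B * norm (?m s - ?m t)"
      proof (rule field_differentiable_bound)
        show "convex I"
          by (simp add: I_def)
        show "(growth N \<mu> has_field_derivative G z) (at z within I)" if "z \<in> I" for z
          using D[OF that] by (rule has_field_derivative_at_within)
        show "norm (G z) \<le> B" if "z \<in> I" for z
          by (rule B(2)[OF that])
      qed (use T(1)[OF st(1)] T(1)[OF st(2)] in \<open>auto simp: I_def\<close>)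
      also have "\<dots> \<le> B * \<bar>s - t\<bar>"
        using B(1) by (intro mult_left_mono) (auto simp: max_def)
      also have "\<bar>s - t\<bar> = sqrt \<bar>s - t\<bar> * sqrt \<bar>s - t\<bar>"
        by simp
      also have "B * \<dots> \<le> B * (sqrt T * sqrt \<bar>s - t\<bar>)"
        using B(1) T(1)[OF st(1)] T(1)[OF st(2)]
        by (intro mult_left_mono mult_right_mono) auto
      finally show ?thesis
        by (simp add: nonlinearity_def powr_half_sqrt mult.assoc)
    qed
    then show "\<exists>C. \<forall>s\<in>K. \<forall>t\<in>K. \<bar>nonlinearity N \<mu> s - nonlinearity N \<mu> t\<bar> \<le> C * \<bar>s - t\<bar> powr (1/2)"
      by blast
  qed
qed auto

lemma cond_f2_nonlinearity: "cond_f2 N (nonlinearity N \<mu>)"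
proof -
  have "filterlim (\<lambda>t. growth N \<mu> t * t powr (1 - real N)) at_top at_top"
    unfolding growth_def using const_pos mu by real_asymp
  then have "eventually (\<lambda>t. 1 \<le> growth N \<mu> t * t powr (1 - real N)) at_top"
    by (simp add: filterlim_at_top)
  then have "eventually (\<lambda>t. 1 \<le> ereal (nonlinearity N \<mu> t * t powr (1 - real N))) at_top"
    using eventually_nonlinearity by eventually_elim simp
  then have "1 \<le> Liminf at_top (\<lambda>t. ereal (nonlinearity N \<mu> t * t powr (1 - real N)))"
    by (rule Liminf_bounded)
  then show ?thesis
    unfolding cond_f2_def by (rule less_le_trans[rotated]) simp
qed

lemma cond_f3_nonlinearity: "cond_f3 N (nonlinearity N \<mu>)"
  unfolding cond_f3_def
  by (intro exI[of _ 1] conjI mono_onI add_mono mult_left_mono power_mono nonlinearity_mono) auto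

lemma continuous_on_nonlinearity: "continuous_on S (nonlinearity N \<mu>)"
proof -
  have "continuous_on {threshold N \<mu>..} (growth N \<mu>)"
    using threshold_pos
    by (intro continuous_at_imp_continuous_on ballI DERIV_isCont[OF DERIV_growth]) auto
  then show ?thesis
    unfolding nonlinearity_def[abs_def]
    by (rule continuous_on_compose2) (auto intro!: continuous_intros)
qed

end

section \<open>The radial solution\<close>

lemma Linf_loc_continuous:
  assumes "continuous_on S h"
  shows "Linf_loc S h"
  unfolding Linf_loc_def
proof (intro allI impI, elim conjE)
  fix K assume K: "compact K" "K \<subseteq> S"
  then have c: "continuous_on K h"
    using assms continuous_on_subset by blast
  then have "bounded (h ` K)"
    using K(1) compact_continuous_image compact_imp_bounded by blast
  then obtain B where "\<forall>x\<in>K. \<bar>h x\<bar> \<le> B"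
    unfolding bounded_iff by auto
  then have "AE x in lebesgue_on K. \<bar>h x\<bar> \<le> B"
    by (intro AE_I2) auto
  moreover have "h \<in> borel_measurable (lebesgue_on K)"
    using c K(1) by (intro continuous_imp_measurable_on_sets_lebesgue) (auto intro: fmeasurableD lmeasurable_compact)
  ultimately show "h \<in> borel_measurable (lebesgue_on K) \<and> (\<exists>C. AE x in lebesgue_on K. \<bar>h x\<bar> \<le> C)"
    by blast
qed

context
  fixes N :: nat and \<mu> :: real
  assumes N: "2 \<le> N" and mu: "1 < \<mu>"
begin

lemma log_arg_ge: "0 < r \<Longrightarrow> r < 1 \<Longrightarrow> real N \<le> real N * (1 - ln r)"
  using N ln_less_zero[of r] by (simp add: algebra_simps mult_nonneg_nonpos)

lemma log_arg_pos: "0 < r \<Longrightarrow> r < 1 \<Longrightarrow> 0 < real N * (1 - ln r)"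
  using log_arg_ge[of r] N by linarith

lemma DERIV_log_arg_powr:
  assumes "0 < r" "r < 1"
  shows "((\<lambda>r. (real N * (1 - ln r)) powr e) has_real_derivative
    - (e * (real N * (1 - ln r)) powr (e - 1) * real N / r)) (at r)"
  using log_arg_pos[OF assms] assms(1) by (auto intro!: derivative_eq_intros)

lemma DERIV_profile:
  assumes "0 < r" "r < 1"
  shows "(profile N \<mu> has_real_derivative - slope N \<mu> r / r) (at r)"
  using DERIV_log_arg_powr[OF assms, of "1 / \<mu>"] mu
  unfolding profile_def[abs_def] by (simp add: slope_def mult.commute)

lemma DERIV_slope:
  assumes "0 < r" "r < 1"
  shows "(slope N \<mu> has_real_derivative
    (1 - 1 / \<mu>) * real N * real N / \<mu> * (real N * (1 - ln r)) powr (1 / \<mu> - 2) / r) (at r)"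
proof -
  have alg: "n / m * - ((i - 1) * X * n / r) = (1 - i) * n * n / m * X / r" for n m i X :: real
    by (simp add: divide_inverse algebra_simps)
  have e: "1 / \<mu> - 1 - 1 = 1 / \<mu> - 2"
    by simp
  show ?thesis
    using DERIV_cmult[OF DERIV_log_arg_powr[OF assms, of "1 / \<mu> - 1"], of "real N / \<mu>"]
    unfolding slope_def[abs_def] alg e .
qed

text \<open>The exponent 1/\<mu> - 1 is negative and its base is at least N \<ge> 1. So the gradient
  of the solution is O(1/|x|), with no logarithm left over.\<close>

lemma slope_bounds:
  assumes "0 < r" "r < 1"
  shows "0 \<le> slope N \<mu> r" "slope N \<mu> r \<le> real N / \<mu>"
proof -
  show "0 \<le> slope N \<mu> r"
    using mu by (simp add: slope_def)
  have "(real N * (1 - ln r)) powr (1 / \<mu> - 1) \<le> (real N * (1 - ln r)) powr 0"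
  proof (rule powr_mono)
    have "1 \<le> real N"
      using N by simp
    then show "1 \<le> real N * (1 - ln r)"
      using log_arg_ge[OF assms] by linarith
  qed (use mu in simp)
  also have "\<dots> = 1"
    using log_arg_pos[OF assms] by (metis less_irrefl powr_zero_eq_one)
  finally show "slope N \<mu> r \<le> real N / \<mu>"
    unfolding slope_def by (rule mult_left_le) (use mu in simp)
qed

lemma nonlinearity_profile:
  assumes "0 < r" "r < 1"
  shows "nonlinearity N \<mu> (profile N \<mu> r) =
    (real N - 1) * (\<mu> - 1) * (real N / \<mu>) ^ N / r ^ N *
    (real N * (1 - ln r)) powr (- (1 + (real N - 1) * (1 - 1 / \<mu>)))"
proof -
  let ?z = "real N * (1 - ln r)"
  have z: "0 < ?z"
    by (rule log_arg_pos[OF assms])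
  have "threshold N \<mu> \<le> profile N \<mu> r"
    unfolding threshold_def profile_def using log_arg_ge[OF assms] mu by (intro powr_mono2) auto
  then have "nonlinearity N \<mu> (profile N \<mu> r) = growth N \<mu> (profile N \<mu> r)"
    by (simp add: nonlinearity_def max_absorb1)
  moreover have "profile N \<mu> r powr \<mu> = ?z"
  proof -
    have "1 / \<mu> * \<mu> = 1"
      using mu by simp
    then show ?thesis
      unfolding profile_def powr_powr using powr_one[OF less_imp_le[OF z]] by (simp only:)
  qed
  moreover have "exp (?z - real N) = 1 / r ^ N"
    using assms by (simp add: algebra_simps exp_diff exp_of_nat_mult exp_minus inverse_eq_divide)
  moreover have "profile N \<mu> r powr (- (1 + real N * (\<mu> - 1))) =
      ?z powr (- (1 + (real N - 1) * (1 - 1 / \<mu>)))"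
  proof -
    \<comment> \<open>Both sides equal -(N - (N - 1)/\<mu>).\<close>
    have "1 / \<mu> * - (1 + real N * (\<mu> - 1)) = - (1 + (real N - 1) * (1 - 1 / \<mu>))"
      using mu by (simp add: field_simps)
    then show ?thesis
      unfolding profile_def powr_powr by (rule arg_cong)
  qed
  ultimately show ?thesis
    by (simp add: growth_def)
qed

text \<open>The radial equation, and the origin of the constant in \<open>growth\<close>: (N - 1)
  from the power, (N/\<mu>)^{N-2} from the remaining slopes, and (1 - 1/\<mu>) N^2/\<mu> = (\<mu> -
  1) (N/\<mu>)^2 from the derivative of \<open>slope\<close>.\<close>

lemma DERIV_flux:
  assumes "0 < r" "r < 1"
  shows "((\<lambda>r. - (slope N \<mu> r ^ (N - 1))) has_real_derivative
    - nonlinearity N \<mu> (profile N \<mu> r) * r ^ (N - 1)) (at r)"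
proof -
  \<comment> \<open>Writing N as m + 2 turns the truncated subtractions in the exponents into
    ordinary arithmetic.\<close>
  obtain m where m: "N = Suc (Suc m)"
    using N by (metis Suc_le_D numeral_2_eq_2 Suc_le_mono)
  let ?z = "real N * (1 - ln r)" and ?c = "real N / \<mu>" and ?k = "1 - 1 / \<mu>"
  have z: "0 < ?z"
    by (rule log_arg_pos[OF assms])
  have "((\<lambda>r. - (slope N \<mu> r ^ (N - 1))) has_real_derivative
      - (real (N - 1) * slope N \<mu> r ^ (N - 1 - 1) * (?k * real N * real N / \<mu> * ?z powr (1 / \<mu> - 2) / r))) (at r)"
    by (rule DERIV_cong[OF DERIV_minus[OF DERIV_power[OF DERIV_slope[OF assms]]]]) simp
  moreover have "real (N - 1) * slope N \<mu> r ^ (N - 1 - 1) * (?k * real N * real N / \<mu> * ?z powr (1 / \<mu> - 2) / r) =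
      nonlinearity N \<mu> (profile N \<mu> r) * r ^ (N - 1)"
  proof -
    have "slope N \<mu> r ^ m = ?c ^ m * ?z powr (real m * (1 / \<mu> - 1))"
      unfolding slope_def power_mult_distrib powr_power[OF less_imp_neq[OF z, symmetric]] by (simp only: mult.commute)
    then have "slope N \<mu> r ^ (N - 1 - 1) * ?z powr (1 / \<mu> - 2) = ?c ^ m * ?z powr (real m * (1 / \<mu> - 1) + (1 / \<mu> - 2))"
      by (simp add: m powr_add)
    also have "real m * (1 / \<mu> - 1) + (1 / \<mu> - 2) = - (1 + (real N - 1) * ?k)"
      by (simp add: m algebra_simps)
    finally have e: "slope N \<mu> r ^ (N - 1 - 1) * ?z powr (1 / \<mu> - 2) = ?c ^ m * ?z powr (- (1 + (real N - 1) * ?k))" .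
    have "real (N - 1) * slope N \<mu> r ^ (N - 1 - 1) * (?k * real N * real N / \<mu> * ?z powr (1 / \<mu> - 2) / r) =
        real (N - 1) * (?k * real N * real N / \<mu>) / r * (slope N \<mu> r ^ (N - 1 - 1) * ?z powr (1 / \<mu> - 2))"
      by simp
    also have "\<dots> = ((real N - 1) * (\<mu> - 1) * ?c ^ N / r ^ N * r ^ (N - 1)) * ?z powr (- (1 + (real N - 1) * ?k))"
    proof -
      have k: "?k = (\<mu> - 1) / \<mu>"
        using mu by (simp add: field_simps)
      have "real (N - 1) * (?k * real N * real N / \<mu>) / r * ?c ^ m = (real N - 1) * (\<mu> - 1) * ?c ^ N / r ^ N * r ^ (N - 1)"
        unfolding k using assms(1) mu by (simp add: m ac_simps)
      then show ?thesis
        unfolding e by (simp only: mult.assoc[symmetric])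
    qed
    finally show ?thesis
      unfolding nonlinearity_profile[OF assms] by simp
  qed
  ultimately show ?thesis
    by simp
qed

lemma continuous_on_slope: "continuous_on {0<..<1} (slope N \<mu>)"
  by (intro continuous_at_imp_continuous_on ballI DERIV_isCont[OF DERIV_slope]) auto

lemma continuous_on_profile: "continuous_on {0<..<1} (profile N \<mu>)"
  by (intro continuous_at_imp_continuous_on ballI DERIV_isCont[OF DERIV_profile]) auto

lemma slope_tendsto_0: "(slope N \<mu> \<longlongrightarrow> 0) (at_right 0)"
proof -
  have "0 < real N"
    using N by simp
  then show ?thesis
    unfolding slope_def[abs_def] using mu by real_asymp
qed

lemma profile_at_top: "filterlim (profile N \<mu>) at_top (at_right 0)"
proof -
  have "0 < real N"
    using N by simp
  then show ?thesis
    unfolding profile_def[abs_def] using mu by real_asymp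
qed

lemma power_mult_profile_tendsto_0: "((\<lambda>r. r ^ (N - 1) * profile N \<mu> r) \<longlongrightarrow> 0) (at_right 0)"
proof -
  have "0 < real N"
    using N by simp
  then have "((\<lambda>r. r * profile N \<mu> r) \<longlongrightarrow> 0) (at_right 0)"
    unfolding profile_def[abs_def] using mu by real_asymp
  \<comment> \<open>The limit 0^(N - 2) is 1 for N = 2 and 0 otherwise; both cases are finite and
    get multiplied by 0.\<close>
  moreover have "((\<lambda>r. r ^ (N - 2)) \<longlongrightarrow> 0 ^ (N - 2)) (at_right (0::real))"
    by (intro tendsto_intros)
  ultimately have "((\<lambda>r. r ^ (N - 2) * (r * profile N \<mu> r)) \<longlongrightarrow> 0 ^ (N - 2) * 0) (at_right 0)"
    by (intro tendsto_mult)
  moreover have "r ^ (N - 1) = r ^ (N - 2) * r" for r :: real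
    using N by (metis One_nat_def Suc_1 Suc_diff_le diff_Suc_Suc power_Suc2)
  ultimately show ?thesis
    by (simp add: mult.assoc)
qed

theorem solution_profile:
  assumes dim: "DIM('a::euclidean_space) = N" and R: "R < 1"
  shows "solution_P0 R (nonlinearity N \<mu>) (\<lambda>x::'a. profile N \<mu> (norm x))"
proof -
  let ?u = "\<lambda>x::'a. profile N \<mu> (norm x)"
  let ?f = "nonlinearity N \<mu>"
  let ?P = "ball (0::'a) R - {0}"
  \<comment> \<open>The first division by |x| yields u', the second normalises x; this is the shape
    that \<open>weak_gradient_radial\<close> produces.\<close>
  define g where "g x = ((- slope N \<mu> (norm x) / norm x) / norm x) *\<^sub>R x" for x :: 'a
  obtain m where m: "N = Suc (Suc m)"
    using N by (metis Suc_le_D numeral_2_eq_2 Suc_le_mono)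
  have r: "0 < norm x" "norm x < 1" if "x \<in> ?P" for x
    using that R by auto
  have sub: "{0<..<R} \<subseteq> {0<..<1}"
    using R by auto
  note cs = continuous_on_subset[OF continuous_on_slope sub]
  note cp = continuous_on_subset[OF continuous_on_profile sub]
  have cu: "continuous_on ?P ?u"
    by (rule continuous_on_radial[OF cp])
  have cg: "continuous_on ?P g"
    unfolding g_def by (intro continuous_intros continuous_on_radial[OF cs]) auto
  have ng: "norm (g x) = slope N \<mu> (norm x) / norm x" if "x \<in> ?P" for x
    using r[OF that] slope_bounds(1)[OF r[OF that]] by (simp add: g_def)
  have u_int: "?u absolutely_integrable_on ball 0 R"
  proof (rule absolutely_integrable_log_bound[OF cu])
    fix x assume x: "x \<in> ?P"
    have "norm x ^ (DIM('a) - 1) * norm (?u x) \<le> 1 * norm (?u x)"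
      using r[OF x] by (intro mult_right_mono power_le_one) auto
    also have "\<dots> = real N powr (1 / \<mu>) * (1 - ln (norm x)) powr (1 / \<mu>)"
      using ln_less_zero[OF r[OF x]] by (simp add: profile_def powr_mult)
    finally show "norm x ^ (DIM('a) - 1) * norm (?u x) \<le> real N powr (1 / \<mu>) * (1 - ln (norm x)) powr (1 / \<mu>)" .
  qed (use R mu in auto)
  have g_int: "g absolutely_integrable_on ball 0 R"
  proof (rule absolutely_integrable_log_bound[OF cg, where q = 0])
    fix x assume x: "x \<in> ?P"
    have "norm x ^ (DIM('a) - 1) * norm (g x) = norm x ^ m * slope N \<mu> (norm x)"
      using r[OF x] by (simp add: ng[OF x] dim m)
    also have "\<dots> \<le> 1 * (real N / \<mu>)"
      using r[OF x] slope_bounds[OF r[OF x]] by (intro mult_mono power_le_one) auto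
    finally show "norm x ^ (DIM('a) - 1) * norm (g x) \<le> real N / \<mu> * (1 - ln (norm x)) powr 0"
      using ln_less_zero[OF r[OF x]] by simp
  qed (use R in auto)
  have slope_pow: "slope N \<mu> (norm x) ^ (N - 1) \<le> (real N / \<mu>) ^ (N - 1) * (1 - ln (norm x)) powr 0"
    if x: "x \<in> ?P" for x
    using slope_bounds[OF r[OF x]] ln_less_zero[OF r[OF x]] by (simp add: power_mono)
  have gN_int: "(\<lambda>x. norm (g x) ^ (DIM('a) - 1)) absolutely_integrable_on ball 0 R"
  proof (rule absolutely_integrable_log_bound[where q = 0 and B = "(real N / \<mu>) ^ (N - 1)"])
    show "continuous_on ?P (\<lambda>x. norm (g x) ^ (DIM('a) - 1))"
      by (intro continuous_intros cg)
    fix x assume x: "x \<in> ?P"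
    have "norm x ^ (DIM('a) - 1) * norm (norm (g x) ^ (DIM('a) - 1)) = slope N \<mu> (norm x) ^ (N - 1)"
      using r[OF x] slope_bounds(1)[OF r[OF x]] by (simp add: ng[OF x] dim power_divide)
    then show "norm x ^ (DIM('a) - 1) * norm (norm (g x) ^ (DIM('a) - 1)) \<le>
        (real N / \<mu>) ^ (N - 1) * (1 - ln (norm x)) powr 0"
      using slope_pow[OF x] by simp
  qed (use R in auto)
  \<comment> \<open>The field |g|^{N-2} g, rewritten as q(|x|) x / |x|^N with q =
    -\<open>slope\<close>^{N-1} for \<open>radial_field_divergence\<close>.\<close>
  let ?V = "\<lambda>x::'a. (- (slope N \<mu> (norm x) ^ (N - 1)) / norm x ^ DIM('a)) *\<^sub>R x"
  have V_int: "?V absolutely_integrable_on ball 0 R"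
  proof (rule absolutely_integrable_log_bound[where q = 0 and B = "(real N / \<mu>) ^ (N - 1)"])
    show "continuous_on ?P ?V"
      by (intro continuous_intros continuous_on_radial[OF cs]) auto
    fix x assume x: "x \<in> ?P"
    have "norm x ^ (DIM('a) - 1) * norm (?V x) = slope N \<mu> (norm x) ^ (N - 1)"
      using r[OF x] slope_bounds(1)[OF r[OF x]] by (simp add: dim m)
    then show "norm x ^ (DIM('a) - 1) * norm (?V x) \<le> (real N / \<mu>) ^ (N - 1) * (1 - ln (norm x)) powr 0"
      using slope_pow[OF x] by simp
  qed (use R in auto)
  \<comment> \<open>The set is left free for two uses: the open punctured ball for integrability,
    and the closed one for boundedness up to the boundary.\<close>
  have cfu: "continuous_on S (\<lambda>x. ?f (?u x))" if "S \<subseteq> ball 0 1 - {0}" for S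
  proof -
    have "continuous_on S ?u"
      using continuous_on_radial[OF continuous_on_profile] that continuous_on_subset by blast
    then show ?thesis
      by (rule continuous_on_compose2[OF continuous_on_nonlinearity[OF N mu]]) auto
  qed
  \<comment> \<open>No power of |x| is spare here: off the origin f(u) equals a constant times the
    logarithmic weight, so the exponent must exceed 1, which follows from N \<ge> 2 and \<mu> >
    1.\<close>
  have f_int: "(\<lambda>x. ?f (?u x)) absolutely_integrable_on ball 0 R"
  proof -
    let ?s = "1 + (real N - 1) * (1 - 1 / \<mu>)"
    let ?C = "(real N - 1) * (\<mu> - 1) * (real N / \<mu>) ^ N * real N powr (- ?s)"
    have s: "1 < ?s"
      using N mu by simp
    have "(\<lambda>x::'a. 1 / (norm x ^ DIM('a) * (1 - ln (norm x)) powr ?s)) absolutely_integrable_on ball 0 R"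
      using absolutely_integrable_log_weight[OF s] by (rule set_integrable_subset) (use R in auto)
    then have i: "(\<lambda>x::'a. ?C * (1 / (norm x ^ DIM('a) * (1 - ln (norm x)) powr ?s))) absolutely_integrable_on ball 0 R"
      by (rule set_integrable_mult_right)
    show ?thesis
    proof (rule absolutely_integrable_punctured_ball[OF _ i])
      show "continuous_on ?P (\<lambda>x. ?f (?u x))"
        by (rule cfu) (use R in auto)
      fix x assume x: "x \<in> ?P"
      have l: "0 \<le> 1 - ln (norm x)"
        using ln_less_zero[OF r[OF x]] by linarith
      have "?f (?u x) = ?C * (1 / (norm x ^ DIM('a) * (1 - ln (norm x)) powr ?s))"
        unfolding nonlinearity_profile[OF r[OF x]] powr_mult[of "real N" "1 - ln (norm x)"] powr_minus[of "1 - ln (norm x)"]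
        by (simp add: dim divide_inverse)
      then show "norm (?f (?u x)) \<le> ?C * (1 / (norm x ^ DIM('a) * (1 - ln (norm x)) powr ?s))"
        unfolding real_norm_def abs_of_nonneg[OF nonlinearity_nonneg[OF N mu]] by (rule eq_refl)
    qed
  qed
  have weak: "weak_gradient (ball 0 R) ?u g"
    unfolding g_def
  proof (rule weak_gradient_radial)
    show "(profile N \<mu> has_real_derivative - slope N \<mu> r / r) (at r)" if "0 < r" "r < R" for r
      using that R by (intro DERIV_profile) auto
    show "continuous_on {0<..<R} (\<lambda>r. - slope N \<mu> r / r)"
      by (intro continuous_intros cs) auto
    show "((\<lambda>r. r ^ (DIM('a) - 1) * profile N \<mu> r) \<longlongrightarrow> 0) (at_right 0)"
      unfolding dim by (rule power_mult_profile_tendsto_0)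
  qed (use u_int g_int in \<open>simp_all add: g_def[abs_def]\<close>)
  have eq: "(LINT x:ball 0 R|lebesgue. norm (g x) ^ (DIM('a) - 2) * (g x \<bullet> grad \<phi> x)) =
      (LINT x:ball 0 R|lebesgue. ?f (?u x) * \<phi> x)" if test: "test_fun (ball 0 R) \<phi>" for \<phi>
  proof -
    \<comment> \<open>At the origin both sides are zero, since both fields are multiples of the
      vector x; the integrands therefore agree on the whole ball.\<close>
    have V: "norm (g x) ^ (DIM('a) - 2) * (g x \<bullet> grad \<phi> x) = ?V x \<bullet> grad \<phi> x" if "x \<in> ball 0 R" for x
    proof (cases "x = 0")
      case True
      then show ?thesis by (simp add: g_def)
    next
      case False
      with that have x: "x \<in> ?P" by simp
      have "norm (g x) ^ (DIM('a) - 2) * (g x \<bullet> grad \<phi> x) =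
          (slope N \<mu> (norm x) / norm x) ^ m * (- slope N \<mu> (norm x) / norm x / norm x) * (x \<bullet> grad \<phi> x)"
        unfolding ng[OF x] by (simp add: g_def dim m)
      also have "(slope N \<mu> (norm x) / norm x) ^ m * (- slope N \<mu> (norm x) / norm x / norm x) =
          - (slope N \<mu> (norm x) ^ (N - 1)) / norm x ^ DIM('a)"
        using r[OF x] by (simp add: dim m power_divide ac_simps)
      finally show ?thesis by simp
    qed
    have "(LINT x:ball 0 R|lebesgue. norm (g x) ^ (DIM('a) - 2) * (g x \<bullet> grad \<phi> x)) =
        (LINT x:ball 0 R|lebesgue. ?V x \<bullet> grad \<phi> x)"
      by (rule set_lebesgue_integral_cong) (use V in auto)
    also have "\<dots> = - (LINT x:ball 0 R|lebesgue. - ?f (?u x) * \<phi> x)"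
    proof (rule radial_field_divergence[where q' = "\<lambda>r. - ?f (profile N \<mu> r) * r ^ (N - 1)", OF _ _ _ V_int _ _ test])
      show "((\<lambda>r. - (slope N \<mu> r ^ (N - 1))) has_real_derivative - ?f (profile N \<mu> r) * r ^ (N - 1)) (at r)"
        if "0 < r" "r < R" for r
        using that R by (intro DERIV_flux) auto
      show "continuous_on {0<..<R} (\<lambda>r. - ?f (profile N \<mu> r) * r ^ (N - 1))"
        by (intro continuous_intros continuous_on_compose2[OF continuous_on_nonlinearity[OF N mu, of UNIV] cp]) auto
      have "((\<lambda>r. - (slope N \<mu> r ^ (N - 1))) \<longlongrightarrow> - (0 ^ (N - 1))) (at_right 0)"
        by (intro tendsto_intros slope_tendsto_0)
      then show "((\<lambda>r. - (slope N \<mu> r ^ (N - 1))) \<longlongrightarrow> 0) (at_right 0)"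
        by (simp add: m)
      show "- ?f (?u x) = - ?f (?u x) * norm x ^ (N - 1) / norm x ^ (DIM('a) - 1)" if "x \<in> ?P" for x
        using r[OF that] by (simp add: dim)
      show "(\<lambda>x. - ?f (?u x)) absolutely_integrable_on ball 0 R"
        using set_integrable_mult_right[of "- 1", OF f_int] by simp
    qed
    also have "\<dots> = (LINT x:ball 0 R|lebesgue. ?f (?u x) * \<phi> x)"
      by (simp add: set_lebesgue_integral_def)
    finally show ?thesis .
  qed
  show ?thesis
    unfolding solution_P0_def
  proof (intro conjI exI[of _ g] ballI allI impI)
    show "0 \<le> ?u x" for x
      by (simp add: profile_def)
    show "L1_loc (ball 0 R) ?u" "L1_loc (ball 0 R) (\<lambda>x. norm (g x) ^ (DIM('a) - 1))"
      using u_int gN_int by (auto intro: L1_loc_absolutely_integrable)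
    show "Linf_loc (cball 0 R - {0}) (\<lambda>x. ?f (?u x))"
      by (rule Linf_loc_continuous[OF cfu]) (use R in auto)
  qed (fact f_int weak | rule eq, assumption)+
qed

lemma blows_up_profile:
  assumes "R < 1"
  shows "blows_up_only_at_origin R (\<lambda>x::'a::euclidean_space. profile N \<mu> (norm x))"
  unfolding blows_up_only_at_origin_def
proof
  show "filterlim (\<lambda>x::'a. profile N \<mu> (norm x)) at_top (at 0)"
    by (rule filterlim_compose[OF profile_at_top filterlim_norm_at_0])
  have "continuous_on (cball 0 R - {0}) (\<lambda>x::'a. profile N \<mu> (norm x))"
    by (rule continuous_on_subset[OF continuous_on_radial[OF continuous_on_profile]]) (use assms in auto)
  then show "Linf_loc (cball 0 R - {0}) (\<lambda>x::'a. profile N \<mu> (norm x))"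
    by (rule Linf_loc_continuous)
qed

end

theorem lemma5p2:
  fixes \<mu> :: real
  assumes "CARD('n::finite) \<ge> 2"
    and "\<mu> > 1"
  shows "\<exists>f :: real \<Rightarrow> real.
    (\<forall>t\<ge>0. f t \<ge> 0) \<and>
    super_exponential f \<and>
    cond_f1 f \<and> cond_f2 (CARD('n)) f \<and> cond_f3 (CARD('n)) f \<and>
    ((\<lambda>t. f t * exp (- (t powr \<mu>))) \<longlongrightarrow> 0) at_top \<and>
    (\<forall>\<epsilon>>0. filterlim (\<lambda>t. f t * exp (- (t powr (\<mu> - \<epsilon>)))) at_top at_top) \<and>
    (\<exists>u :: real ^ 'n \<Rightarrow> real.
       solution_P0 (1/2) f u \<and>
       radial_on (ball 0 (1/2)) u \<and>
       blows_up_only_at_origin (1/2) u)"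
proof (intro exI conjI allI impI)
  let ?f = "nonlinearity CARD('n) \<mu>"
  let ?u = "\<lambda>x::real^'n. profile CARD('n) \<mu> (norm x)"
  show "?f t \<ge> 0" for t
    by (rule nonlinearity_nonneg[OF assms])
  show "super_exponential ?f"
    by (rule super_exponential_nonlinearity[OF assms])
  show "cond_f1 ?f" "cond_f2 CARD('n) ?f" "cond_f3 CARD('n) ?f"
    by (rule cond_f1_nonlinearity[OF assms] cond_f2_nonlinearity[OF assms] cond_f3_nonlinearity[OF assms])+
  show "((\<lambda>t. ?f t * exp (- (t powr \<mu>))) \<longlongrightarrow> 0) at_top"
    by (rule nonlinearity_upper[OF assms])
  show "filterlim (\<lambda>t. ?f t * exp (- (t powr (\<mu> - \<epsilon>)))) at_top at_top" if "\<epsilon> > 0" for \<epsilon>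
    by (rule nonlinearity_lower[OF assms that])
  show "solution_P0 (1/2) ?f ?u"
    by (rule solution_profile[OF assms]) auto
  show "radial_on (ball 0 (1/2)) ?u"
    unfolding radial_on_def by blast
  show "blows_up_only_at_origin (1/2) ?u"
    by (rule blows_up_profile[OF assms]) auto
qed

end
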